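(* For all integers $k\geq 1$ and $n\geq 2k+1$, the Kneser graph $K(n,k)$ has a cycle that visits at least a $\frac{2k}{n}$-fraction of all its vertices. In particular, for every $k\geq 1$, the odd graph $K(2k+1,k)$ has a cycle that visits at least a $\left(1-\frac{1}{2k+1}\right)$-fraction of all its vertices.
   Context: For integers $k\geq 1$ and $n\geq 2k+1$, the Kneser graph $K(n,k)$ is the graph whose vertices are all $k$-element subsets of $[n]=\{1,2,\ldots,n\}$, with an edge between two vertices whenever the two sets are disjoint. The odd graph is $K(2k+1,k)$. (For $k=1$, $K(n,1)$ is the complete graph on $n$ vertices, and a cycle visiting all its vertices counts as well.) *)

theory Defs
  imports Complex_Main "Graph_Theory.Graph_Theory"
begin

text \<open>
  Undirected graphs are represented, as in the locale \<open>pair_graph\<close>, by symmetric loop-free digraphs: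
  each edge is a pair of opposite arcs.
\<close>

definition kneser_graph :: "nat \<Rightarrow> nat \<Rightarrow> nat set pair_pre_digraph" where
  "kneser_graph n k =
    \<lparr> pverts = {A. A \<subseteq> {1..n} \<and> card A = k},
      parcs = {(A, B). A \<subseteq> {1..n} \<and> card A = k \<and> B \<subseteq> {1..n} \<and> card B = k \<and> A \<inter> B = {}} \<rparr>"

definition odd_graph :: "nat \<Rightarrow> nat set pair_pre_digraph" where
  "odd_graph k = kneser_graph (2 * k + 1) k"

text \<open>
  The library's digraph cycles include the closed walk of length 2 that traverses an edge back and
  forth, which is not a cycle of the undirected graph; the length bound excludes it.
\<close>

definition graph_cycle :: "'a pair_pre_digraph \<Rightarrow> ('a \<times> 'a) list \<Rightarrow> bool" where
  "graph_cycle G p \<longleftrightarrow> pre_digraph.cycle (with_proj G) p \<and> 3 \<le> length p"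

text \<open>Since a cycle is closed, its vertices are the tails of its arcs.\<close>

definition cycle_verts :: "('a \<times> 'a) list \<Rightarrow> 'a set" where
  "cycle_verts p = fst ` set p"

lemma pverts_kneser_graph: "pverts (kneser_graph n k) = {A. A \<subseteq> {1..n} \<and> card A = k}"
  by (simp add: kneser_graph_def)

lemma in_parcs_kneser_graph:
  "e \<in> parcs (kneser_graph n k) \<longleftrightarrow>
    fst e \<in> pverts (kneser_graph n k) \<and> snd e \<in> pverts (kneser_graph n k) \<and> fst e \<inter> snd e = {}"
  by (cases e) (simp add: kneser_graph_def)

lemma pair_graph_kneser_graph:
  assumes "1 \<le> k"
  shows "pair_graph (kneser_graph n k)"
proof -
  let ?G = "kneser_graph n k"
  have fin_verts: "finite (pverts ?G)"
    unfolding pverts_kneser_graph by (rule finite_subset[of _ "Pow {1..n}"]) blast+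
  have "parcs ?G \<subseteq> pverts ?G \<times> pverts ?G"
    using in_parcs_kneser_graph[of _ n k] by (metis mem_Times_iff subsetI)
  then have fin_arcs: "finite (parcs ?G)"
    using finite_cartesian_product[OF fin_verts fin_verts] by (rule finite_subset)
  have ends: "arcs_ends (with_proj ?G) = parcs ?G"
    by simp
  have "sym (parcs ?G)"
  proof (rule symI)
    fix A B assume "(A, B) \<in> parcs ?G"
    then show "(B, A) \<in> parcs ?G"
      unfolding in_parcs_kneser_graph fst_conv snd_conv by (metis Int_commute)
  qed
  then have symm: "symmetric (with_proj ?G)"
    unfolding symmetric_def ends .
  have loopfree: "fst e \<noteq> snd e" if "e \<in> parcs ?G" for e
  proof
    assume "fst e = snd e"
    then have "fst e = {}" "card (fst e) = k"
      using that unfolding in_parcs_kneser_graph pverts_kneser_graph by blast+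
    then show False using assms by simp
  qed
  show ?thesis
    by unfold_locales
      (rule fin_verts fin_arcs symm | erule loopfree
        | erule in_parcs_kneser_graph[THEN iffD1, THEN conjunct1]
        | erule in_parcs_kneser_graph[THEN iffD1, THEN conjunct2, THEN conjunct1])+
qed

lemma card_pverts_kneser_graph: "card (pverts (kneser_graph n k)) = n choose k"
  using n_subsets[of "{1..n}" k] by (simp add: pverts_kneser_graph)

end

theory Submission
  imports Defs
begin

text \<open>
  Write \<open>m = n - 1\<close> and \<open>j = k - 1\<close>; the cycle has length \<open>2 (m choose j) = (2 k / n) (n choose k)\<close> and
  alternates between \<open>k\<close>-sets that contain \<open>n\<close> and \<open>k\<close>-sets that do not. It comes from a cycle between the
  levels \<open>j\<close> and \<open>j + 1\<close> of the \<open>m\<close>-cube that visits every \<open>j\<close>-set: append \<open>n\<close> to the \<open>j\<close>-sets, and replace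
  each \<open>(j + 1)\<close>-set by the complement of its partner under a perfect matching, by inclusion, between the
  levels \<open>j + 1\<close> and \<open>m - j - 1\<close>.

  Such saturating cycles exist for all \<open>m \<ge> 2 j + 1\<close>. For \<open>m > 2 j + 1\<close>, split the cube along its last
  coordinate and join the two smaller cycles through a set that the second one misses. For \<open>m = 2 j + 1\<close>
  this is the middle levels theorem. Following Muetze, a vertex with \<open>j\<close> ones is a cyclic shift of \<open>y 0\<close>
  for a unique Dyck word \<open>y\<close>, and the steps
  \<open>1 u 0 v 0 \<rightarrow> 1 u 1 v 0 \<rightarrow> 0 u 1 v 0\<close> partition the graph into cycles that correspond to the plane trees with
  \<open>j\<close> edges. A 6-cycle merges the cycles of \<open>1 1 0 u 0 v\<close> and \<open>1 0 1 u 0 v\<close>, and these moves lead from every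
  plane tree to the star. Adding the cycles one by one, starting with the star, uses each gluing edge once.
\<close>

section \<open>Gluing cycles\<close>

fun path_arcs :: "'a list \<Rightarrow> ('a \<times> 'a) set" where
  "path_arcs [] = {}"
| "path_arcs [x] = {}"
| "path_arcs (x # y # zs) = insert (x, y) (path_arcs (y # zs))"

text \<open>For the empty list this is one arbitrary arc, hence the hypotheses of nonemptiness
  below.\<close>

definition cycle_arcs :: "'a list \<Rightarrow> ('a \<times> 'a) set" where
  "cycle_arcs vs = insert (last vs, hd vs) (path_arcs vs)"

lemma path_arcs_append:
  assumes "xs \<noteq> []" "ys \<noteq> []"
  shows "path_arcs (xs @ ys) = path_arcs xs \<union> path_arcs ys \<union> {(last xs, hd ys)}"
  using assms
proof (induction xs rule: path_arcs.induct)
  case (2 x)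
  then show ?case by (cases ys) auto
qed auto

lemma path_arcs_rev: "path_arcs (rev xs) = (path_arcs xs)\<inverse>"
proof (induction xs rule: path_arcs.induct)
  case (3 x y zs)
  have "path_arcs (rev (x # y # zs)) = path_arcs (rev (y # zs) @ [x])" by simp
  also have "\<dots> = path_arcs (rev (y # zs)) \<union> {(y, x)}"
    by (subst path_arcs_append) (auto simp: last_rev)
  finally show ?case using 3 by auto
qed auto

lemma path_arcs_map: "path_arcs (map g xs) = map_prod g g ` path_arcs xs"
  by (induction xs rule: path_arcs.induct) auto

lemma path_arcs_subset: "path_arcs xs \<subseteq> set xs \<times> set xs"
  by (induction xs rule: path_arcs.induct) auto

lemma cycle_arcs_append:
  assumes "xs \<noteq> []" "ys \<noteq> []"
  shows "cycle_arcs (xs @ ys) = path_arcs xs \<union> path_arcs ys \<union> {(last xs, hd ys), (last ys, hd xs)}"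
  using assms by (auto simp: cycle_arcs_def path_arcs_append)

lemma cycle_arcs_append_commute: "cycle_arcs (xs @ ys) = cycle_arcs (ys @ xs)"
  by (cases "xs = [] \<or> ys = []") (auto simp: cycle_arcs_append)

lemma cycle_arcs_rev: "vs \<noteq> [] \<Longrightarrow> cycle_arcs (rev vs) = (cycle_arcs vs)\<inverse>"
  by (auto simp: cycle_arcs_def path_arcs_rev hd_rev last_rev)

lemma cycle_arcs_map: "vs \<noteq> [] \<Longrightarrow> cycle_arcs (map g vs) = map_prod g g ` cycle_arcs vs"
  by (auto simp: cycle_arcs_def path_arcs_map hd_map last_map)

lemma path_arcs_decomp:
  assumes "(a, b) \<in> path_arcs vs"
  shows "\<exists>p q. vs = p @ [a] @ b # q"
  using assms
proof (induction vs rule: path_arcs.induct)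
  case (3 x y zs)
  show ?case
  proof (cases "(a, b) = (x, y)")
    case True
    then have "x # y # zs = [] @ [a] @ b # zs" by simp
    then show ?thesis by blast
  next
    case False
    then obtain p q where "y # zs = p @ [a] @ b # q" using 3 by auto
    then have "x # y # zs = (x # p) @ [a] @ b # q" by simp
    then show ?thesis by blast
  qed
qed auto

text \<open>Cuts a cycle open at a chosen arc, which becomes the closing one and can then be
  replaced.\<close>

lemma cycle_arcs_rotate_to:
  assumes "vs \<noteq> []" "(a, b) \<in> cycle_arcs vs" "distinct vs"
  obtains us where "distinct us" "set us = set vs" "cycle_arcs us = cycle_arcs vs"
    "us \<noteq> []" "hd us = b" "last us = a"
proof (cases "(a, b) \<in> path_arcs vs")
  case True
  then obtain p q where "vs = p @ [a] @ b # q" using path_arcs_decomp by fast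
  then have vs: "vs = (p @ [a]) @ (b # q)" by simp
  show thesis
  proof (rule that[of "(b # q) @ (p @ [a])"])
    show "cycle_arcs ((b # q) @ p @ [a]) = cycle_arcs vs"
      unfolding vs by (rule cycle_arcs_append_commute)
  qed (use assms(3) in \<open>auto simp: vs\<close>)
next
  case False
  then have "a = last vs" "b = hd vs" using assms(2) by (auto simp: cycle_arcs_def)
  then show thesis using that[of vs] assms by auto
qed

lemma cycle_arcs_rotate_last:
  assumes "a \<in> set vs" "distinct vs"
  obtains us where "distinct us" "set us = set vs" "cycle_arcs us = cycle_arcs vs"
    "us \<noteq> []" "last us = a"
proof -
  obtain p q where vs: "vs = (p @ [a]) @ q" using split_list[OF assms(1)] by auto
  show thesis
  proof (rule that[of "q @ (p @ [a])"])
    show "cycle_arcs (q @ p @ [a]) = cycle_arcs vs"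
      unfolding vs by (rule cycle_arcs_append_commute)
  qed (use assms(2) in \<open>auto simp: vs\<close>)
qed

lemma path_arcs_map_upt:
  "path_arcs (map g [a..<b]) = {(g i, g (Suc i)) |i. a \<le> i \<and> Suc i < b}"
proof (induction b)
  case (Suc b)
  show ?case
  proof (cases "a < b")
    case True
    then have "map g [a..<Suc b] = map g [a..<b] @ [g b]" by simp
    moreover have "last (map g [a..<b]) = g (b - 1)" using True by (simp add: last_map)
    ultimately have "path_arcs (map g [a..<Suc b])
        = insert (g (b - 1), g b) {(g i, g (Suc i)) |i. a \<le> i \<and> Suc i < b}"
      using True Suc by (simp add: path_arcs_append)
    also have "\<dots> = {(g i, g (Suc i)) |i. a \<le> i \<and> Suc i < Suc b}" (is "?L = ?R")
    proof
      show "?L \<subseteq> ?R" using True by (force intro: exI[of _ "b - 1"])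
      show "?R \<subseteq> ?L"
      proof
        fix e assume "e \<in> ?R"
        then obtain i where i: "e = (g i, g (Suc i))" "a \<le> i" "Suc i < Suc b" by blast
        show "e \<in> ?L"
        proof (cases "Suc i = b")
          case True then show ?thesis using i(1) by auto
        next
          case False then show ?thesis using i by auto
        qed
      qed
    qed
    finally show ?thesis .
  qed (auto simp: not_less)
qed auto

text \<open>An injective self-map of a finite set brings \<open>x\<close> back to itself. The list
  runs from \<open>f x\<close> to \<open>x\<close>, so its path has every arc of the orbit except
  \<open>(x, f x)\<close>, the one that a gluing removes.\<close>

lemma permutation_orbit_list:
  assumes "finite V" "inj_on f V" "f ` V \<subseteq> V" "x \<in> V"
  obtains C where "C \<noteq> []" "distinct C" "set C \<subseteq> V" "hd C = f x" "last C = x" "f ` set C \<subseteq> set C"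
    "path_arcs C = {(v, f v) |v. v \<in> set C \<and> v \<noteq> x}"
proof -
  define g where "g i = (f ^^ i) x" for i
  have gV: "g i \<in> V" for i
    unfolding g_def using assms(3,4) by (induction i) auto
  have gS: "g (Suc i) = f (g i)" for i by (simp add: g_def)
  \<comment> \<open>Injectivity strips common iterates and turns any repetition into a return to
    \<open>x\<close>.\<close>
  have cancel: "g i = g (i + d) \<Longrightarrow> g d = x" for i d
  proof (induction i)
    case 0 then show ?case by (simp add: g_def)
  next
    case (Suc i)
    then have "f (g i) = f (g (i + d))" by (simp add: gS)
    then have "g i = g (i + d)" using assms(2) gV by (auto dest: inj_onD)
    then show ?case using Suc by simp
  qed
  have "\<not> inj g"
  proof
    assume "inj g"
    then have "infinite (range g)" using finite_imageD infinite_UNIV_nat by blast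
    moreover have "range g \<subseteq> V" using gV by auto
    ultimately show False using assms(1) finite_subset by blast
  qed
  then obtain i d where "g i = g (i + d)" "0 < d"
    by (metis inj_onI less_imp_add_positive nat_neq_iff)
  then have ex: "\<exists>p. 0 < p \<and> g p = x" using cancel by blast
  define p where "p = (LEAST p. 0 < p \<and> g p = x)"
  have p: "0 < p" "g p = x" using LeastI_ex[OF ex] by (auto simp: p_def)
  have least: "p \<le> q" if "0 < q" "g q = x" for q
    unfolding p_def using that by (intro Least_le) auto
  have ne: "g i \<noteq> g j" if "0 < i" "i < j" "j \<le> p" for i j
  proof
    assume "g i = g j"
    then have "g (j - i) = x" using cancel[of i "j - i"] that by simp
    then show False using least[of "j - i"] that by simp
  qed
  have inj: "inj_on g {1..<Suc p}"
    by (intro linorder_inj_onI) (use ne in auto)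
  define C where "C = map g [1..<Suc p]"
  have setC: "set C = g ` {1..<Suc p}" unfolding C_def by (simp del: upt_Suc)
  show thesis
  proof (rule that[of C])
    show "C \<noteq> []" using p(1) by (simp add: C_def)
    show "distinct C" unfolding C_def distinct_map using inj by (simp del: upt_Suc)
    show "set C \<subseteq> V" using gV by (auto simp: setC)
    show "hd C = f x" using p(1) by (simp add: C_def hd_map g_def del: upt_Suc)
    show "last C = x" using p by (simp add: C_def)
    show "f ` set C \<subseteq> set C"
    proof
      fix w assume "w \<in> f ` set C"
      then obtain i where w: "w = g (Suc i)" and i: "i \<in> {1..<Suc p}" by (auto simp: setC gS)
      have "g (Suc i) \<in> g ` {1..<Suc p}"
      proof (cases "i = p")
        case True
        then have "g (Suc i) = g (Suc 0)" by (simp add: gS p(2)) (simp add: g_def)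
        then show ?thesis using p(1) by auto
      next
        case False then show ?thesis using i by auto
      qed
      then show "w \<in> set C" by (simp only: w setC)
    qed
    show "path_arcs C = {(v, f v) |v. v \<in> set C \<and> v \<noteq> x}"
      unfolding setC unfolding C_def path_arcs_map_upt
    proof (intro equalityI subsetI)
      fix e assume "e \<in> {(g i, g (Suc i)) |i. 1 \<le> i \<and> Suc i < Suc p}"
      then obtain i where "e = (g i, f (g i))" "1 \<le> i" "i < p" by (auto simp: gS)
      moreover from this have "g i \<noteq> x" using ne[of i p] p by auto
      ultimately show "e \<in> {(v, f v) |v. v \<in> g ` {1..<Suc p} \<and> v \<noteq> x}" by auto
    next
      fix e assume "e \<in> {(v, f v) |v. v \<in> g ` {1..<Suc p} \<and> v \<noteq> x}"
      then obtain i where i: "e = (g i, g (Suc i))" "i \<in> {1..<Suc p}" "g i \<noteq> x" by (auto simp: gS)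
      then have "i \<noteq> p" using p by auto
      then show "e \<in> {(g i, g (Suc i)) |i. 1 \<le> i \<and> Suc i < Suc p}" using i by auto
    qed
  qed
qed

text \<open>Dropping \<open>(y, y')\<close> from the first cycle, and \<open>(x, x')\<close> and
  \<open>(b, z)\<close> from the second, leaves the path \<open>h\<close> and the paths from
  \<open>x'\<close> to \<open>b\<close> and from \<open>z\<close> to \<open>x\<close>. The arcs
  \<open>(x, y')\<close>, \<open>(y, b)\<close> and \<open>(x', z)\<close> join them into one cycle,
  on which the path from \<open>x'\<close> to \<open>b\<close> runs backwards. The last two
  conclusions record which old arcs survive.\<close>

lemma glue_two_cycles:
  assumes h: "h \<noteq> []" "distinct h" "hd h = y'" "last h = y"
    and C: "distinct C" "hd C = x'" "last C = x" "b \<in> set C" "b \<noteq> x"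
    and disj: "set h \<inter> set C = {}"
  obtains us z where "us \<noteq> []" "distinct us" "set us = set h \<union> set C" "(b, z) \<in> path_arcs C"
    "cycle_arcs us \<subseteq> path_arcs h \<union> path_arcs C \<union> (path_arcs C)\<inverse> \<union> {(x, y'), (y, b), (x', z)}"
    "path_arcs h \<subseteq> cycle_arcs us"
    "path_arcs C - {(b, z)} \<subseteq> cycle_arcs us \<union> (cycle_arcs us)\<inverse>"
proof -
  obtain P Q where PQ: "C = (P @ [b]) @ Q" using split_list[OF C(4)] by auto
  have Q: "Q \<noteq> []" "last Q = x" using C PQ by auto
  define z where "z = hd Q"
  have hdP: "hd (P @ [b]) = x'" using C(2) PQ by (cases P) auto
  have arcs: "path_arcs C = path_arcs (P @ [b]) \<union> path_arcs Q \<union> {(b, z)}"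
    unfolding PQ by (subst path_arcs_append) (auto simp: Q z_def)
  define us where "us = Q @ (h @ rev (P @ [b]))"
  have R: "path_arcs (h @ rev (P @ [b])) = path_arcs h \<union> (path_arcs (P @ [b]))\<inverse> \<union> {(y, b)}"
    by (subst path_arcs_append) (use h in \<open>auto simp: path_arcs_rev[of "P @ [b]", simplified]\<close>)
  have "last (rev (P @ [b])) = x'" using hdP by (metis last_rev append_is_Nil_conv not_Cons_self2)
  then have "last (h @ rev (P @ [b])) = x'" by simp
  moreover have "hd (h @ rev (P @ [b])) = y'" using h by simp
  ultimately have U: "cycle_arcs us = path_arcs Q \<union> (path_arcs h \<union> (path_arcs (P @ [b]))\<inverse> \<union> {(y, b)})
      \<union> {(x, y'), (x', z)}"
    unfolding us_def by (subst cycle_arcs_append) (use Q h R in \<open>auto simp: z_def\<close>)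
  show thesis
  proof (rule that[of us z])
    show "us \<noteq> []" using Q by (simp add: us_def)
    show "distinct us" "set us = set h \<union> set C"
      using h C disj by (auto simp: us_def PQ)
    show "(b, z) \<in> path_arcs C" using arcs by auto
    show "cycle_arcs us \<subseteq> path_arcs h \<union> path_arcs C \<union> (path_arcs C)\<inverse> \<union> {(x, y'), (y, b), (x', z)}"
      unfolding U arcs by auto
    show "path_arcs h \<subseteq> cycle_arcs us" unfolding U by auto
    show "path_arcs C - {(b, z)} \<subseteq> cycle_arcs us \<union> (cycle_arcs us)\<inverse>" unfolding U arcs by auto
  qed
qed

lemma rtrancl_enters_set:
  assumes "(a, r) \<in> R\<^sup>*" "a \<notin> S" "r \<in> S"
  obtains v w where "(v, w) \<in> R" "v \<notin> S" "w \<in> S"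
  using assms by (induction rule: converse_rtrancl_induct) blast+

text \<open>A triple \<open>(x, y, b)\<close> stands for the 6-cycle \<open>x, f x, f b, b, y, f y\<close>. Exchanging its edges merges the
  orbit of \<open>x\<close> with a cycle through the edge \<open>y, f y\<close>. By \<open>G_inj\<close> and \<open>G_disj\<close>, that edge survives all
  other exchanges, since the orbit of \<open>x\<close> is merged only once.\<close>

theorem hamilton_cycle_by_gluing_orbits:
  fixes f :: "'a \<Rightarrow> 'a" and E :: "('a \<times> 'a) set" and G :: "('a \<times> 'a \<times> 'a) set"
  assumes V: "finite V" "inj_on f V" "f ` V \<subseteq> V" "r \<in> V"
    and symE: "sym E" and fE: "\<And>v. v \<in> V \<Longrightarrow> (v, f v) \<in> E"
    and f2: "\<And>v. v \<in> V \<Longrightarrow> f (f v) \<noteq> v"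
    and G: "\<And>x y b. (x, y, b) \<in> G \<Longrightarrow> x \<in> V \<and> y \<in> V \<and> b \<noteq> x \<and> (\<exists>i. b = (f ^^ i) x) \<and>
        (f x, f b) \<in> E \<and> (b, y) \<in> E \<and> (f y, x) \<in> E"
    and G_inj: "\<And>x x' y b b'. (x, y, b) \<in> G \<Longrightarrow> (x', y, b') \<in> G \<Longrightarrow> x = x'"
    and G_disj: "\<And>x y b x' y' b'. (x, y, b) \<in> G \<Longrightarrow> (x', y', b') \<in> G \<Longrightarrow> x \<noteq> y' \<and> b \<noteq> y'"
    and reach: "\<And>v. v \<in> V \<Longrightarrow> (v, r) \<in> ({(v, f v) |v. v \<in> V} \<union> {(x, y). \<exists>b. (x, y, b) \<in> G})\<^sup>*"
  shows "\<exists>vs. vs \<noteq> [] \<and> distinct vs \<and> set vs = V \<and> cycle_arcs vs \<subseteq> E"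
proof -
  \<comment> \<open>The invariant: \<open>S\<close> is a union of orbits spanned by one cycle, and
    this cycle still has, in some direction, the edge \<open>y, f y\<close> of every gluing that
    leads into \<open>S\<close> from outside.\<close>
  define I where "I S \<longleftrightarrow> S \<subseteq> V \<and> r \<in> S \<and> f ` S \<subseteq> S \<and> (\<exists>vs. vs \<noteq> [] \<and> distinct vs \<and> set vs = S \<and>
      cycle_arcs vs \<subseteq> E \<and>
      (\<forall>x y b. (x, y, b) \<in> G \<longrightarrow> y \<in> S \<longrightarrow> x \<notin> S \<longrightarrow> (y, f y) \<in> cycle_arcs vs \<union> (cycle_arcs vs)\<inverse>))" for S
  have init: "\<exists>S. I S"
  proof -
    obtain C where C: "C \<noteq> []" "distinct C" "set C \<subseteq> V" "hd C = f r" "last C = r" "f ` set C \<subseteq> set C"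
      "path_arcs C = {(v, f v) |v. v \<in> set C \<and> v \<noteq> r}"
      using permutation_orbit_list[OF V] by blast
    have arcs: "cycle_arcs C = {(v, f v) |v. v \<in> set C}"
      using C last_in_set[of C] by (auto simp: cycle_arcs_def)
    then have "I (set C)"
      unfolding I_def using C fE last_in_set[of C] by (auto intro!: exI[of _ C])
    then show ?thesis ..
  qed
  have step: "\<exists>S'. I S' \<and> S \<subset> S'" if S: "I S" "S \<noteq> V" for S
  proof -
    obtain h0 where h0: "h0 \<noteq> []" "distinct h0" "set h0 = S" "cycle_arcs h0 \<subseteq> E"
      and h0G: "\<And>x y b. (x, y, b) \<in> G \<Longrightarrow> y \<in> S \<Longrightarrow> x \<notin> S \<Longrightarrow> (y, f y) \<in> cycle_arcs h0 \<union> (cycle_arcs h0)\<inverse>"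
      using S unfolding I_def by blast
    have SV: "S \<subseteq> V" "r \<in> S" "f ` S \<subseteq> S" using S unfolding I_def by auto
    have "f ` S = S"
      using SV V by (intro endo_inj_surj) (auto intro: finite_subset inj_on_subset)
    \<comment> \<open>\<open>f\<close> permutes \<open>S\<close>, so a path to \<open>r\<close> can
      enter \<open>S\<close> only by a gluing.\<close>
    then have f_back: "v \<in> S" if vV: "v \<in> V" and fvS: "f v \<in> S" for v
    proof -
      obtain s where "s \<in> S" "f v = f s" using fvS \<open>f ` S = S\<close> by (metis imageE)
      then show ?thesis using vV SV(1) inj_onD[OF V(2), of v s] by auto
    qed
    obtain v where v: "v \<in> V" "v \<notin> S" using S SV by blast
    obtain x y where xy: "(x, y) \<in> {(v, f v) |v. v \<in> V} \<union> {(x, y). \<exists>b. (x, y, b) \<in> G}" "x \<notin> S" "y \<in> S"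
      using rtrancl_enters_set[OF reach[OF v(1)] v(2) SV(2)] by blast
    then obtain b where b: "(x, y, b) \<in> G" using f_back by auto
    note Gb = G[OF b]
    have "\<exists>h. h \<noteq> [] \<and> distinct h \<and> set h = S \<and> hd h = f y \<and> last h = y \<and>
        cycle_arcs h \<union> (cycle_arcs h)\<inverse> = cycle_arcs h0 \<union> (cycle_arcs h0)\<inverse>"
    proof (cases "(y, f y) \<in> cycle_arcs h0")
      case True
      show ?thesis by (rule cycle_arcs_rotate_to[OF h0(1) True h0(2)]) (use h0 in auto)
    next
      case False
      then have *: "(y, f y) \<in> cycle_arcs (rev h0)"
        using h0G[OF b xy(3,2)] by (auto simp: cycle_arcs_rev[OF h0(1)])
      show ?thesis
        by (rule cycle_arcs_rotate_to[OF _ *]) (use h0 in \<open>auto simp: cycle_arcs_rev[OF h0(1)]\<close>)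
    qed
    then obtain h where h: "h \<noteq> []" "distinct h" "set h = S" "hd h = f y" "last h = y"
      and hh0: "cycle_arcs h \<union> (cycle_arcs h)\<inverse> = cycle_arcs h0 \<union> (cycle_arcs h0)\<inverse>" by blast
    have hE: "path_arcs h \<subseteq> E"
    proof -
      have "cycle_arcs h \<subseteq> E \<union> E\<inverse>" using hh0 h0(4) by blast
      then show ?thesis using symE by (auto simp: cycle_arcs_def sym_conv_converse_eq)
    qed
    obtain C where C: "C \<noteq> []" "distinct C" "set C \<subseteq> V" "hd C = f x" "last C = x" "f ` set C \<subseteq> set C"
      "path_arcs C = {(v, f v) |v. v \<in> set C \<and> v \<noteq> x}"
      using permutation_orbit_list[OF V(1,2,3)] Gb by blast
    have xC: "x \<in> set C" using C by auto
    have "(f ^^ i) x \<in> set C" for i using xC C(6) by (induction i) auto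
    then have bC: "b \<in> set C" using Gb by auto
    \<comment> \<open>Once in \<open>S\<close>, the list stays in \<open>S\<close> up to its end,
      which is \<open>x\<close> and lies outside.\<close>
    have CS: "v \<notin> S" if "v \<in> set C" for v
    proof
      assume "v \<in> S"
      obtain p q where pq: "C = p @ v # q" using split_list[OF \<open>v \<in> set C\<close>] by blast
      have "set q \<subseteq> S" if "path_arcs (v # q) \<subseteq> path_arcs C" "v \<in> S" for v q
        using that
      proof (induction q arbitrary: v)
        case (Cons w q)
        then have "w = f v" using C(7) by auto
        then have "w \<in> S" using Cons.prems SV by auto
        then show ?case using Cons by auto
      qed simp
      moreover have "path_arcs (v # q) \<subseteq> path_arcs C"
        unfolding pq by (cases "p = []") (auto simp: path_arcs_append)
      ultimately have "set (v # q) \<subseteq> S" using \<open>v \<in> S\<close> by auto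
      moreover have "x \<in> set (v # q)" using C(5) pq by (metis last_appendR last_in_set list.distinct(1))
      ultimately show False using xy(2) by auto
    qed
    then have disj: "set h \<inter> set C = {}" using h(3) by auto
    obtain us z where us: "us \<noteq> []" "distinct us" "set us = set h \<union> set C" "(b, z) \<in> path_arcs C"
      and us_sub: "cycle_arcs us \<subseteq> path_arcs h \<union> path_arcs C \<union> (path_arcs C)\<inverse> \<union> {(x, f y), (y, b), (f x, z)}"
      and us_h: "path_arcs h \<subseteq> cycle_arcs us"
      and us_C: "path_arcs C - {(b, z)} \<subseteq> cycle_arcs us \<union> (cycle_arcs us)\<inverse>"
      using glue_two_cycles[OF h(1,2,4,5) C(2,4,5) bC _ disj] Gb by blast
    have z: "z = f b" using us(4) C(7) by auto
    have CE: "path_arcs C \<subseteq> E" using C(3,7) fE by auto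
    have "I (S \<union> set C)"
      unfolding I_def
    proof (intro conjI exI[of _ us] allI impI)
      show "S \<union> set C \<subseteq> V" "r \<in> S \<union> set C" "f ` (S \<union> set C) \<subseteq> S \<union> set C"
        using SV C by auto
      show "cycle_arcs us \<subseteq> E"
      proof -
        have "(path_arcs C)\<inverse> \<subseteq> E" using CE symE by (auto simp: sym_def)
        moreover have "(x, f y) \<in> E" "(y, b) \<in> E" "(f x, z) \<in> E" using Gb symE z by (auto simp: sym_def)
        ultimately show ?thesis using us_sub hE CE by blast
      qed
      show "set us = S \<union> set C" using us h by auto
      fix x1 y1 b1 assume G1: "(x1, y1, b1) \<in> G" "y1 \<in> S \<union> set C" "x1 \<notin> S \<union> set C"
      show "(y1, f y1) \<in> cycle_arcs us \<union> (cycle_arcs us)\<inverse>"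
      proof (cases "y1 \<in> S")
        case True
        then have "(y1, f y1) \<in> cycle_arcs h \<union> (cycle_arcs h)\<inverse>" using h0G[OF G1(1)] G1(3) hh0 by auto
        \<comment> \<open>By \<open>G_inj\<close>, \<open>y1 = y\<close> would give
          \<open>x1 = x\<close>, but \<open>x\<close> has just been absorbed. The merge thus
          destroys no pending edge of the old cycle.\<close>
        moreover have "y1 \<noteq> y" using G_inj b G1 xC by blast
        moreover have "(y1, f y1) \<noteq> (f y, y)" using f2[of y] Gb by auto
        ultimately have "(y1, f y1) \<in> path_arcs h \<union> (path_arcs h)\<inverse>"
          using h by (auto simp: cycle_arcs_def)
        then show ?thesis using us_h by auto
      next
        case False
        then have "y1 \<in> set C" using G1 by auto
        \<comment> \<open>The orbit loses only its arcs at \<open>x\<close> and \<open>b\<close>,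
          and by \<open>G_disj\<close> neither starts a pending edge.\<close>
        moreover have "y1 \<noteq> x" "y1 \<noteq> b" using G_disj[OF b G1(1)] by auto
        ultimately have "(y1, f y1) \<in> path_arcs C - {(b, z)}" using C(7) by auto
        then show ?thesis using us_C by auto
      qed
    qed (use us in auto)
    moreover have "S \<subset> S \<union> set C" using xC xy(2) by auto
    ultimately show ?thesis by blast
  qed
  have "\<exists>S. I S \<and> (\<forall>S'. I S' \<longrightarrow> card S' \<le> card S)"
  proof -
    obtain S0 where "I S0" using init by blast
    moreover have "\<forall>S. I S \<longrightarrow> card S < Suc (card V)"
      using V(1) by (auto simp: I_def less_Suc_eq_le intro: card_mono)
    ultimately show ?thesis by (rule Lattices_Big.ex_has_greatest_nat)
  qed
  then obtain S where S: "I S" "\<And>S'. I S' \<Longrightarrow> card S' \<le> card S" by blast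
  have "S = V"
  proof (rule ccontr)
    assume "S \<noteq> V"
    then obtain S' where S': "I S'" "S \<subset> S'" using step S(1) by blast
    then have "finite S'" using V(1) finite_subset by (auto simp: I_def)
    then show False using psubset_card_mono[of S' S] S' S(2)[of S'] by auto
  qed
  then show ?thesis using S(1) unfolding I_def by blast
qed

section \<open>Dyck words\<close>

text \<open>The first-return decomposition \<open>1 a 0 b\<close>. As plane trees,
  \<open>Arch a b\<close> is \<open>b\<close> with \<open>a\<close> attached to its root as new
  first subtree.\<close>

datatype dyck = Nul | Arch dyck dyck

fun semilength :: "dyck \<Rightarrow> nat" where
  "semilength Nul = 0"
| "semilength (Arch a b) = Suc (semilength a + semilength b)"

fun word :: "dyck \<Rightarrow> bool list" where
  "word Nul = []"
| "word (Arch a b) = True # word a @ False # word b"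

fun cat :: "dyck \<Rightarrow> dyck \<Rightarrow> dyck" (infixr \<open>\<star>\<close> 65) where
  "Nul \<star> t = t"
| "Arch a b \<star> t = Arch a (b \<star> t)"

text \<open>On plane trees this moves the root to its first child.\<close>

fun rot :: "dyck \<Rightarrow> dyck" where
  "rot Nul = Nul"
| "rot (Arch a b) = a \<star> Arch b Nul"

lemma cat_Nul [simp]: "t \<star> Nul = t"
  by (induction t) auto

lemma cat_assoc [simp]: "(s \<star> t) \<star> u = s \<star> (t \<star> u)"
  by (induction s) auto

lemma word_cat [simp]: "word (s \<star> t) = word s @ word t"
  by (induction s) auto

lemma semilength_cat [simp]: "semilength (s \<star> t) = semilength s + semilength t"
  by (induction s) auto

lemma semilength_rot [simp]: "semilength (rot t) = semilength t"
  by (cases t) auto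

lemma length_word [simp]: "length (word t) = 2 * semilength t"
  by (induction t) auto

lemma cat_Arch_ne_Nul [simp]: "a \<star> Arch b c \<noteq> Nul" "Nul \<noteq> a \<star> Arch b c"
  by (cases a; simp)+

lemma cat_Arch_Nul_inject: "a \<star> Arch b Nul = a' \<star> Arch b' Nul \<longleftrightarrow> a = a' \<and> b = b'"
proof (induction a arbitrary: a')
  case Nul
  then show ?case by (cases a') auto
next
  case (Arch c d)
  then show ?case by (cases a') auto
qed

lemma inj_rot: "inj rot"
proof (rule injI)
  fix s t assume "rot s = rot t"
  then show "s = t" by (cases s; cases t) (auto simp: cat_Arch_Nul_inject dest: sym)
qed

text \<open>Reading a Dyck word as a non-crossing perfect matching of the points of a circle, \<open>rot\<close>
  rotates the matching by one point.\<close>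

lemma rot_funpow_cat: "(rot ^^ (2 * semilength u)) (u \<star> v) = v \<star> u"
proof (induction u arbitrary: v)
  case (Arch a b)
  have "2 * semilength (Arch a b) = 2 * semilength b + (1 + (2 * semilength a + 1))"
    by simp
  then have "(rot ^^ (2 * semilength (Arch a b))) (Arch a b \<star> v)
      = (rot ^^ (2 * semilength b)) (rot ((rot ^^ (2 * semilength a)) (rot (Arch a (b \<star> v)))))"
    by (simp only: funpow_add comp_apply One_nat_def funpow.simps id_apply cat.simps)
  also have "\<dots> = v \<star> Arch a b"
    by (simp add: Arch.IH)
  finally show ?case .
qed simp

lemma rot_funpow_period: "(rot ^^ (2 * semilength t)) t = t"
  using rot_funpow_cat[of t Nul] by simp

text \<open>Rotations stay on one cycle of the middle levels graph, and \<open>pull\<close> stands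
  for a gluing. On plane trees, \<open>pull\<close> takes a leaf that is the first child of the
  root's first child and attaches it to the root. Gluings are followed in this direction
  only.\<close>

inductive_set moves :: "(dyck \<times> dyck) set" where
  rot: "(t, rot t) \<in> moves"
| pull: "(Arch (Arch Nul u) v, Arch Nul (Arch u v)) \<in> moves"

lemma moves_semilength: "(s, t) \<in> moves\<^sup>* \<Longrightarrow> semilength s = semilength t"
proof (induction rule: rtrancl_induct)
  case (step t u)
  then show ?case by (auto elim: moves.cases)
qed simp

lemma moves_rot_funpow: "(t, (rot ^^ i) t) \<in> moves\<^sup>*"
  by (induction i) (auto intro: moves.rot rtrancl_into_rtrancl)

lemma moves_cat_commute: "(u \<star> v, v \<star> u) \<in> moves\<^sup>*"
  using moves_rot_funpow[of "u \<star> v" "2 * semilength u"] by (simp add: rot_funpow_cat)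

text \<open>Some positive power of \<open>rot\<close> fixes \<open>t\<close>, so a further power
  undoes a rotation.\<close>

lemma moves_unrot: "(rot t, t) \<in> moves\<^sup>*"
proof (cases t)
  case (Arch a b)
  then obtain k where "2 * semilength t = Suc k" by (cases "2 * semilength t") auto
  then have "(rot ^^ k) (rot t) = t"
    using rot_funpow_period[of t] by (simp add: funpow_swap1)
  then show ?thesis using moves_rot_funpow[of "rot t" k] by simp
qed simp

section \<open>Reducing plane trees to the star\<close>

fun star :: "nat \<Rightarrow> dyck" where
  "star 0 = Nul"
| "star (Suc k) = Arch Nul (star k)"

lemma semilength_star [simp]: "semilength (star k) = k"
  by (induction k) auto

lemma star_add: "star (i + k) = star i \<star> star k"
  by (induction i) auto

text \<open>Each leaf is pulled to the root and then rotated to the far end, which brings the next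
  leaf to the front.\<close>

lemma moves_pull_leaves: "(Arch (star r \<star> b) v, Arch b (v \<star> star r)) \<in> moves\<^sup>*"
proof (induction r arbitrary: v)
  case (Suc r)
  have "(Arch (star (Suc r) \<star> b) v, Arch Nul (Arch (star r \<star> b) v)) \<in> moves\<^sup>*"
    by (auto intro: moves.pull)
  also have "(Arch Nul (Arch (star r \<star> b) v), Arch (star r \<star> b) v \<star> Arch Nul Nul) \<in> moves\<^sup>*"
    using moves_cat_commute[of "Arch Nul Nul" "Arch (star r \<star> b) v"] by simp
  also have "(Arch (star r \<star> b) v \<star> Arch Nul Nul, Arch b ((v \<star> star 1) \<star> star r)) \<in> moves\<^sup>*"
    using Suc[of "v \<star> star 1"] by simp
  also have "(v \<star> star 1) \<star> star r = v \<star> star (Suc r)"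
    using star_add[of 1 r] by simp
  finally show ?case .
qed simp

text \<open>For \<open>u = Arch a b\<close>, a rotation makes \<open>a\<close> a subtree of the
  root, where induction flattens it. Rotating back puts the resulting leaves below the root's first
  child; they are pulled out, and induction flattens \<open>b\<close>.\<close>

lemma moves_flatten: "(Arch u v, star (Suc (semilength u)) \<star> v) \<in> moves\<^sup>*"
proof (induction "semilength u" arbitrary: u v rule: less_induct)
  case less
  show ?case
  proof (cases u)
    case (Arch a b)
    let ?r = "Suc (semilength a)"
    have "(Arch (Arch a b) v, Arch a (b \<star> Arch v Nul)) \<in> moves\<^sup>*"
      using moves.rot[of "Arch (Arch a b) v"] by auto
    also have "(Arch a (b \<star> Arch v Nul), star ?r \<star> (b \<star> Arch v Nul)) \<in> moves\<^sup>*"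
      using Arch by (intro less) simp
    also have "(star ?r \<star> (b \<star> Arch v Nul), Arch (star ?r \<star> b) v) \<in> moves\<^sup>*"
      using moves_unrot[of "Arch (star ?r \<star> b) v"] by simp
    also have "(Arch (star ?r \<star> b) v, Arch b (v \<star> star ?r)) \<in> moves\<^sup>*"
      by (rule moves_pull_leaves)
    also have "(Arch b (v \<star> star ?r), star (Suc (semilength b)) \<star> (v \<star> star ?r)) \<in> moves\<^sup>*"
      using Arch by (intro less) simp
    also have "(star (Suc (semilength b)) \<star> (v \<star> star ?r), star ?r \<star> star (Suc (semilength b)) \<star> v) \<in> moves\<^sup>*"
      using moves_cat_commute[of "star (Suc (semilength b)) \<star> v" "star ?r"] by simp
    also have "star ?r \<star> star (Suc (semilength b)) \<star> v = star (Suc (semilength u)) \<star> v"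
      using star_add[of ?r "Suc (semilength b)"] Arch by simp
    finally show ?thesis using Arch by simp
  qed simp
qed

text \<open>\<open>r\<close> counts the leaves collected at the end: flatten the first subtree,
  rotate its leaves to the end, and continue with the rest.\<close>

lemma moves_to_star: "(t \<star> star r, star (semilength t + r)) \<in> moves\<^sup>*"
proof (induction "semilength t" arbitrary: t r rule: less_induct)
  case less
  show ?case
  proof (cases t)
    case (Arch u v)
    let ?m = "Suc (semilength u)"
    have "(Arch u (v \<star> star r), star ?m \<star> (v \<star> star r)) \<in> moves\<^sup>*"
      by (rule moves_flatten)
    also have "(star ?m \<star> (v \<star> star r), v \<star> star r \<star> star ?m) \<in> moves\<^sup>*"
      using moves_cat_commute[of "star ?m" "v \<star> star r"] by simp
    also have "v \<star> star r \<star> star ?m = v \<star> star (r + ?m)"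
      by (simp only: star_add)
    also have "(v \<star> star (r + ?m), star (semilength v + (r + ?m))) \<in> moves\<^sup>*"
      using Arch by (intro less) simp
    also have "semilength v + (r + ?m) = semilength t + r" using Arch by simp
    finally show ?thesis using Arch by simp
  qed simp
qed

section \<open>Heights of lattice paths and the cycle lemma\<close>

definition height :: "bool list \<Rightarrow> int" where
  "height w = (\<Sum>b\<leftarrow>w. if b then 1 else - 1)"

lemma height_simps [simp]:
  "height [] = 0" "height (b # w) = (if b then 1 else - 1) + height w" "height (v @ w) = height v + height w"
  by (auto simp: height_def)

lemma height_word [simp]: "height (word t) = 0"
  by (induction t) auto

lemma height_word_prefix: "word t = p @ q \<Longrightarrow> 0 \<le> height p"
proof (induction t arbitrary: p q)
  case (Arch a b)
  show ?case
  proof (cases p)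
    case (Cons c p')
    then have *: "word a @ False # word b = p' @ q" "c" using Arch.prems by auto
    from *(1) consider us where "word a = p' @ us" | us where "p' = word a @ us" "False # word b = us @ q"
      by (auto simp: append_eq_append_conv2)
    then show ?thesis
    proof cases
      case 1 then show ?thesis using Arch.IH(1) Cons *(2) by fastforce
    next
      case 2
      then show ?thesis using Arch.IH(2) Cons *(2) by (cases us) fastforce+
    qed
  qed simp
qed simp

text \<open>The \<open>False\<close> after a Dyck word is the first descent below zero, so the word
  can be read off.\<close>

lemma word_False_inject:
  "word s @ False # p = word t @ False # q \<Longrightarrow> s = t \<and> p = q"
proof (induction s arbitrary: t p q)
  case Nul
  then show ?case by (cases t) auto
next
  case (Arch a b)
  obtain c d where t: "t = Arch c d" using Arch.prems by (cases t) auto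
  then have "word a @ False # (word b @ False # p) = word c @ False # (word d @ False # q)"
    using Arch.prems by simp
  then have "a = c" "word b @ False # p = word d @ False # q" using Arch.IH(1) by blast+
  then show ?case using Arch.IH(2) t by blast
qed

lemma word_inject [simp]: "word s = word t \<longleftrightarrow> s = t"
  using word_False_inject[of s "[]" t "[]"] by auto

lemma first_descent:
  "height w < 0 \<Longrightarrow> \<exists>t r. w = word t @ False # r"
proof (induction "length w" arbitrary: w rule: less_induct)
  case less
  show ?case
  proof (cases w)
    case (Cons c w')
    show ?thesis
    proof (cases c)
      case False
      then have "w = word Nul @ False # w'" using Cons by simp
      then show ?thesis by blast
    next
      case True
      then obtain a w'' where a: "w' = word a @ False # w''" using less Cons by fastforce
      moreover have "height w'' < 0" using less.prems Cons True a by simp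
      ultimately obtain b r where "w'' = word b @ False # r" using less.hyps[of w''] Cons by fastforce
      then have "w = word (Arch a b) @ False # r" using Cons True a by simp
      then show ?thesis by blast
    qed
  qed (use less.prems in simp)
qed

text \<open>Cut the word at the first position \<open>i\<close> of minimal height. The rotated word
  then reaches -1 only at its very end, so it is a Dyck word followed by
  \<open>False\<close>.\<close>

lemma cycle_lemma:
  assumes "height w = - 1"
  shows "\<exists>t i. i < length w \<and> w = rotate i (word t @ [False])"
proof -
  define H where "H i = height (take i w)" for i
  define m where "m = Min (H ` {..length w})"
  have m_le: "m \<le> H i" if "i \<le> length w" for i
    unfolding m_def using that by (intro Min_le) auto
  have ex: "\<exists>i. i \<le> length w \<and> H i = m"
  proof -
    have "m \<in> H ` {..length w}" unfolding m_def by (rule Min_in) auto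
    then show ?thesis by auto
  qed
  define i where "i = (LEAST i. i \<le> length w \<and> H i = m)"
  have i: "i \<le> length w" "H i = m" using LeastI_ex[OF ex] by (auto simp: i_def)
  have less_i: "m < H j" if "j < i" for j
  proof -
    have "\<not> (j \<le> length w \<and> H j = m)" using not_less_Least that unfolding i_def by blast
    then show ?thesis using that m_le[of j] i(1) by auto
  qed
  have split: "height w = H i + height (drop i w)"
    by (metis H_def append_take_drop_id height_simps(3))
  define v where "v = drop i w @ take i w"
  have "height v = - 1" using split assms by (simp add: v_def H_def)
  then obtain t r where v: "v = word t @ False # r" using first_descent[of v] by auto
  \<comment> \<open>An earlier descent to -1 within \<open>drop i w\<close> would go below the
    minimum \<open>m\<close>; one in the part wrapped around would attain \<open>m\<close> at a
    position before \<open>i\<close>.\<close>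
  have "r = []"
  proof (rule ccontr)
    assume "r \<noteq> []"
    define P where "P = word t @ [False]"
    have P: "v = P @ r" "height P = - 1" by (auto simp: P_def v)
    from P(1) consider us where "drop i w = P @ us" | us where "P = drop i w @ us" "take i w = us @ r"
      by (auto simp: v_def append_eq_append_conv2)
    then show False
    proof cases
      case 1
      then have "take (i + length P) w = take i w @ P" by (simp add: take_add)
      then have "H (i + length P) = m - 1" using i(2) P(2) by (simp add: H_def)
      moreover have "i + length P \<le> length w" using arg_cong[OF 1, of length] i(1) by simp
      ultimately show False using m_le[of "i + length P"] by simp
    next
      case 2
      have len: "length us < i" using arg_cong[OF 2(2), of length] \<open>r \<noteq> []\<close> i(1) by simp
      then have "us = take (length us) w"
        using 2(2) by (metis append_eq_conv_conj less_imp_le_nat min.absorb1 take_take)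
      then have "height us > m" using less_i[OF len] by (simp add: H_def)
      then show False using 2(1) P(2) split i(2) assms by simp
    qed
  qed
  then have v': "v = word t @ [False]" using v by simp
  have N: "0 < length w" using assms by (cases w) auto
  have "w = take i w @ drop i w" by simp
  also have "\<dots> = rotate (length (drop i w)) (drop i w @ take i w)" by (simp only: rotate_append)
  also have "\<dots> = rotate (length (drop i w) mod length w) (word t @ [False])"
    by (metis v_def v' rotate_conv_mod length_append append_take_drop_id add.commute)
  finally show ?thesis using N by (metis mod_less_divisor)
qed

section \<open>Uniqueness of cyclic shifts and the states they define\<close>

lemma rotate_inject [simp]: "rotate i xs = rotate i ys \<longleftrightarrow> xs = ys"
  unfolding rotate_def by (metis inj_fn inj_rotate1 injD)

text \<open>A nontrivial shift moves a nonempty prefix \<open>p\<close> of the Dyck word behind the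
  \<open>False\<close>. The remainder \<open>q\<close> in front of that \<open>False\<close> then
  has height at least 1, but \<open>p\<close> has height at least 0 and the two heights sum to
  0.\<close>

lemma rotate_word_False_unique:
  assumes "word s @ [False] = rotate k (word t @ [False])" "k < length (word t @ [False])"
  shows "k = 0"
proof (rule ccontr)
  assume "k \<noteq> 0"
  obtain p q where pq: "word t = p @ q" "length p = k"
    using assms(2) by (metis append_take_drop_id length_append_singleton length_take less_Suc_eq_le min.absorb2)
  then have "word s @ [False] = (q @ [False]) @ p"
    using assms(1) rotate_append[of p "q @ [False]"] by simp
  moreover obtain c p' where "p = p' @ [c]" using pq(2) \<open>k \<noteq> 0\<close> by (cases p rule: rev_cases) auto
  ultimately have "word s = (q @ [False]) @ p'" by simp
  then have "1 \<le> height q" using height_word_prefix[of s "q @ [False]"] by simp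
  moreover have "0 \<le> height p" using height_word_prefix[of t p q] pq by simp
  moreover have "height p + height q = 0" using height_word[of t] pq by simp
  ultimately show False by simp
qed

text \<open>The same count of heights: here \<open>q\<close> begins with the surplus
  \<open>True\<close>.\<close>

lemma rotate_True_word_unique:
  assumes "True # word s = rotate k (True # word t)" "k < length (True # word t)"
  shows "k = 0"
proof (rule ccontr)
  assume "k \<noteq> 0"
  then obtain k' where k': "k = Suc k'" by (cases k) auto
  obtain p q where pq: "word t = p @ q" "length p = k'"
    using assms(2) k' by (metis Suc_less_eq append_take_drop_id length_Cons length_take less_imp_le_nat min.absorb2)
  then have *: "True # word s = q @ True # p"
    using assms(1) k' rotate_append[of "True # p" q] by simp
  have "q \<noteq> []" using pq assms(2) k' by auto
  then obtain q' where q: "q = True # q'" using * by (cases q) auto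
  then have "word s = q' @ True # p" using * by simp
  then have "1 \<le> height q" using height_word_prefix[of s q'] q by simp
  moreover have "0 \<le> height p" using height_word_prefix[of t p q] pq by simp
  moreover have "height p + height q = 0" using height_word[of t] pq by simp
  ultimately show False by simp
qed

text \<open>Serves both levels, with \<open>g\<close> giving the unshifted word: an equation between
  two shifts reduces to a single shift by the difference.\<close>

lemma rotate_inject2:
  assumes u: "\<And>s t k. P s \<Longrightarrow> P t \<Longrightarrow> g s = rotate k (g t) \<Longrightarrow> k < N \<Longrightarrow> k = 0"
    and "rotate i (g s) = rotate j (g t)" "i < N" "j < N" "P s" "P t"
  shows "i = j \<and> g s = g t"
proof -
  have *: "i = j" if "rotate i (g s) = rotate j (g t)" "i < N" "j < N" "P s" "P t" "i \<le> j" for i j s t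
  proof -
    have "rotate i (g s) = rotate i (rotate (j - i) (g t))"
      using that by (simp add: rotate_rotate)
    then have "g s = rotate (j - i) (g t)" by simp
    then have "j - i = 0" using u that by (metis less_imp_diff_less)
    then show ?thesis using that by simp
  qed
  have "i = j" using *[of i s j t] *[of j t i s] assms(2-) by (metis linear)
  then show ?thesis using assms(2) by simp
qed

text \<open>A state \<open>(t, i, False)\<close> is the vertex on the lower middle level obtained from \<open>word t\<close> followed by a zero by
  a cyclic shift of \<open>i\<close> positions; \<open>(t, i, True)\<close> is its successor on the upper middle level.\<close>

type_synonym state = "dyck \<times> nat \<times> bool"

definition states :: "nat \<Rightarrow> state set" where
  "states n = {(t, i, c). semilength t = n \<and> i < 2 * n + 1}"

text \<open>\<open>(i + 2 * n) mod (2 * n + 1)\<close> is \<open>i - 1\<close> modulo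
  \<open>2 * n + 1\<close>: the word \<open>0 w\<close> shifted by \<open>i\<close> is
  \<open>w 0\<close> shifted by \<open>i - 1\<close>.\<close>

fun next_state :: "nat \<Rightarrow> state \<Rightarrow> state" where
  "next_state n (t, i, False) = (t, i, True)"
| "next_state n (t, i, True) = (rot t, (i + 2 * n) mod (2 * n + 1), False)"

text \<open>For \<open>t = Arch a b\<close>, \<open>True # word (rot t)\<close> is
  \<open>1 a 1 b 0\<close>, that is, \<open>1 a 0 b 0\<close> with the zero after \<open>a\<close>
  raised.\<close>

fun label :: "state \<Rightarrow> bool list" where
  "label (t, i, False) = rotate i (word t @ [False])"
| "label (t, i, True) = rotate i (True # word (rot t))"

lemma height_rotate [simp]: "height (rotate i w) = height w"
proof (induction i)
  case (Suc i)
  have "height (rotate1 v) = height v" for v by (cases v) auto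
  then show ?case using Suc by simp
qed simp

lemma length_label: "s \<in> states n \<Longrightarrow> length (label s) = 2 * n + 1"
  by (cases s rule: label.cases) (auto simp: states_def)

lemma height_label: "height (label (t, i, c)) = (if c then 1 else - 1)"
  by (cases c) auto

lemma inj_on_label: "inj_on label (states n)"
proof (rule inj_onI)
  fix s s' assume s: "s \<in> states n" "s' \<in> states n" "label s = label s'"
  obtain t i c t' i' c' where ss: "s = (t, i, c)" "s' = (t', i', c')" by (cases s, cases s') auto
  have "c = c'" using height_label[of t i c] height_label[of t' i' c'] s(3) ss by (auto split: if_splits)
  have lt: "i < 2 * n + 1" "i' < 2 * n + 1" "semilength t = n" "semilength t' = n"
    using s ss by (auto simp: states_def)
  show "s = s'"
  proof (cases c)
    case True
    have u: "k = 0" if "semilength p = n" "semilength q = n"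
      "True # word (rot p) = rotate k (True # word (rot q))" "k < 2 * n + 1" for p q k
      by (rule rotate_True_word_unique[OF that(3)]) (use that in simp)
    have "i = i' \<and> True # word (rot t) = True # word (rot t')"
      by (rule rotate_inject2[where P = "\<lambda>t. semilength t = n", OF u])
        (use lt s(3) ss True \<open>c = c'\<close> in simp_all)
    then show ?thesis using ss \<open>c = c'\<close> inj_rot by (auto dest: injD)
  next
    case False
    have u: "k = 0" if "semilength p = n" "semilength q = n"
      "word p @ [False] = rotate k (word q @ [False])" "k < 2 * n + 1" for p q k
      by (rule rotate_word_False_unique[OF that(3)]) (use that in simp)
    have "i = i' \<and> word t @ [False] = word t' @ [False]"
      by (rule rotate_inject2[where P = "\<lambda>t. semilength t = n", OF u])
        (use lt s(3) ss False \<open>c = c'\<close> in simp_all)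
    then show ?thesis using ss \<open>c = c'\<close> by auto
  qed
qed

lemma label_surj:
  assumes "length w = 2 * n + 1" "height w = - 1"
  shows "w \<in> label ` states n"
proof -
  obtain t i where ti: "i < length w" "w = rotate i (word t @ [False])"
    using cycle_lemma[OF assms(2)] by auto
  then have "length w = 2 * semilength t + 1" by simp
  then have "(t, i, False) \<in> states n" using ti assms by (simp add: states_def)
  then show ?thesis using ti(2) by (metis label.simps(1) image_eqI)
qed

lemma finite_states: "finite (states n)"
proof (rule inj_on_finite[OF inj_on_label])
  show "label ` states n \<subseteq> {w. set w \<subseteq> UNIV \<and> length w = 2 * n + 1}" using length_label by auto
  show "finite {w :: bool list. set w \<subseteq> UNIV \<and> length w = 2 * n + 1}"
    by (rule finite_lists_length_eq) simp
qed

section \<open>The middle levels of the cube\<close>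

definition raise :: "bool list \<Rightarrow> bool list \<Rightarrow> bool" where
  "raise v w \<longleftrightarrow> (\<exists>p q. v = p @ False # q \<and> w = p @ True # q)"

lemma raiseI: "raise (p @ False # q) (p @ True # q)"
  unfolding raise_def by blast

lemma raise_rotate1: "raise v w \<Longrightarrow> raise (rotate1 v) (rotate1 w)"
proof -
  assume "raise v w"
  then obtain p q where vw: "v = p @ False # q" "w = p @ True # q" unfolding raise_def by blast
  show ?thesis
  proof (cases p)
    case Nil
    then show ?thesis using raiseI[of q "[]"] vw by simp
  next
    case (Cons c p')
    then show ?thesis using raiseI[of p' "q @ [c]"] vw by simp
  qed
qed

lemma raise_rotate: "raise v w \<Longrightarrow> raise (rotate i v) (rotate i w)"
  by (induction i) (auto intro: raise_rotate1)

definition raise_rel :: "(state \<times> state) set" where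
  "raise_rel = {(s, t). raise (label s) (label t) \<or> raise (label t) (label s)}"

lemma sym_raise_rel: "sym raise_rel"
  by (auto simp: sym_def raise_rel_def)

lemma next_state_in: "s \<in> states n \<Longrightarrow> next_state n s \<in> states n"
  by (cases s rule: label.cases) (auto simp: states_def)

lemma rotate_pred:
  assumes "length w = 2 * n"
  shows "rotate ((i + 2 * n) mod (2 * n + 1)) (w @ [c]) = rotate i (c # w)"
proof -
  have "rotate ((i + 2 * n) mod (2 * n + 1)) (w @ [c]) = rotate (i + 2 * n) (w @ [c])"
    using rotate_conv_mod[of "i + 2 * n" "w @ [c]"] assms by simp
  also have "\<dots> = rotate i (rotate (length w) (w @ [c]))" using assms by (simp add: rotate_rotate)
  finally show ?thesis by (simp only: rotate_append) simp
qed

lemma inj_on_next_state: "inj_on (next_state n) (states n)"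
proof (rule inj_onI)
  fix s s' assume s: "s \<in> states n" "s' \<in> states n" "next_state n s = next_state n s'"
  have mod: "i = j" if "(i + 2 * n) mod (2 * n + 1) = (j + 2 * n) mod (2 * n + 1)" "i < 2 * n + 1" "j < 2 * n + 1" for i j
  proof -
    have "(i + 2 * n + 1) mod (2 * n + 1) = (j + 2 * n + 1) mod (2 * n + 1)"
      using that(1) by (metis mod_add_left_eq)
    then have "(i + (2 * n + 1)) mod (2 * n + 1) = (j + (2 * n + 1)) mod (2 * n + 1)"
      by (simp only: add.assoc)
    then show ?thesis using that(2,3) by (simp only: mod_add_self2 mod_less)
  qed
  obtain t i c t' i' c' where ss: "s = (t, i, c)" "s' = (t', i', c')" by (cases s, cases s') auto
  have "c = c'" using s(3) ss by (cases c; cases c') auto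
  show "s = s'"
  proof (cases c)
    case True
    then have "rot t = rot t'" "(i + 2 * n) mod (2 * n + 1) = (i' + 2 * n) mod (2 * n + 1)"
      using s(3) ss \<open>c = c'\<close> by simp_all
    moreover have "i < 2 * n + 1" "i' < 2 * n + 1" using s(1,2) ss by (auto simp: states_def)
    ultimately show ?thesis using ss \<open>c = c'\<close> mod injD[OF inj_rot] by blast
  next
    case False
    then show ?thesis using s(3) ss \<open>c = c'\<close> by simp
  qed
qed

lemma next_state_raise:
  assumes "s \<in> states n" "0 < n"
  shows "(s, next_state n s) \<in> raise_rel"
proof (cases s rule: label.cases)
  case (1 t i)
  then obtain a b where t: "t = Arch a b" using assms by (cases t) (auto simp: states_def)
  have "raise (rotate i ((True # word a) @ False # word b @ [False])) (rotate i ((True # word a) @ True # word b @ [False]))"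
    by (rule raise_rotate[OF raiseI])
  then show ?thesis using 1 t by (simp add: raise_rel_def)
next
  case (2 t i)
  have "length (word (rot t)) = 2 * n" using 2 assms by (simp add: states_def)
  then have "label (next_state n s) = rotate i (False # word (rot t))"
    using 2 rotate_pred[of "word (rot t)" n i False] by simp
  moreover have "raise (rotate i (False # word (rot t))) (rotate i (True # word (rot t)))"
    using raise_rotate[OF raiseI[of "[]"]] by simp
  ultimately show ?thesis using 2 by (simp add: raise_rel_def)
qed

lemma next_state_two:
  assumes "s \<in> states n" "0 < n"
  shows "next_state n (next_state n s) \<noteq> s"
proof -
  have "(i + 2 * n) mod (2 * n + 1) \<noteq> i" if "i < 2 * n + 1" for i
  proof (cases i)
    case 0 then show ?thesis using assms by simp
  next
    case (Suc k)
    then have "(i + 2 * n) mod (2 * n + 1) = k" using that by (simp add: mod_if)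
    then show ?thesis using Suc by simp
  qed
  then show ?thesis using assms by (cases s rule: label.cases) (auto simp: states_def)
qed

text \<open>As \<open>2 * n\<close> and \<open>2 * n + 1\<close> are coprime, every rotation of
  \<open>t\<close> occurs with every shift. Orbits therefore correspond to rotation classes of Dyck
  words, the plane trees.\<close>

lemma next_state_orbit:
  assumes "semilength t = n" "i < 2 * n + 1" "j < 2 * n + 1"
  shows "\<exists>k. (next_state n ^^ k) (t, i, False) = ((rot ^^ m) t, j, False)"
proof -
  let ?N = "2 * n + 1"
  have two: "(next_state n ^^ (2 * k)) (t, i, False) = ((rot ^^ k) t, (i + k * (2 * n)) mod ?N, False)" for k
  proof (induction k)
    case 0 then show ?case using assms by simp
  next
    case (Suc k)
    have "(next_state n ^^ (2 * Suc k)) (t, i, False) = next_state n (next_state n ((next_state n ^^ (2 * k)) (t, i, False)))"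
      by simp
    then show ?case using Suc by (simp add: mod_simps ac_simps)
  qed
  have period: "(rot ^^ (2 * n * q)) t = t" for q
  proof (induction q)
    case (Suc q)
    have "2 * n * Suc q = 2 * n * q + 2 * semilength t" using assms by simp
    then show ?case by (simp only: funpow_add comp_apply rot_funpow_period Suc)
  qed simp
  text \<open>The position decreases by one per step modulo \<open>2 n + 1\<close>, while \<open>rot\<close> has period \<open>2 n\<close>.\<close>
  define q where "q = j + m + 2 * n * i"
  have "(next_state n ^^ (2 * (m + 2 * n * q))) (t, i, False)
      = ((rot ^^ m) t, (i + (m + 2 * n * q) * (2 * n)) mod ?N, False)"
    unfolding two by (simp only: funpow_add comp_apply period)
  \<comment> \<open>Modulo \<open>2 * n + 1\<close>, \<open>2 * n\<close> is -1: the position is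
    \<open>i - m + q\<close>, and \<open>q\<close> is \<open>j + m - i\<close>, with
    \<open>2 * n * i\<close> in place of \<open>-i\<close> to stay in \<open>nat\<close>.\<close>
  moreover have "(i + (m + 2 * n * q) * (2 * n)) mod ?N = j"
  proof -
    have "int (i + (m + 2 * n * q) * (2 * n)) = int j + int ?N * (int i + int m + (2 * int n - 1) * int q)"
      by (simp add: q_def algebra_simps)
    then have "int (i + (m + 2 * n * q) * (2 * n)) mod int ?N = int j"
      using assms(3) by simp
    then show ?thesis by (metis of_nat_eq_iff of_nat_mod)
  qed
  ultimately show ?thesis by metis
qed

text \<open>The labels of the three states are \<open>1 1 0 u 0 v 0\<close>, \<open>1 0 1 u 0 v 0\<close> and \<open>1 0 1 u 1 v 0\<close>; together with
  their successors they run through the six words of the form \<open>1 * * u * v 0\<close> on the two levels.\<close>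

definition gluings :: "nat \<Rightarrow> (state \<times> state \<times> state) set" where
  "gluings n = {((Arch (Arch Nul u) v, 0, False), (Arch Nul (Arch u v), 0, False),
     (Arch (u \<star> Arch v Nul) Nul, 2 * n - 1, True)) |u v. Suc (Suc (semilength u + semilength v)) = n}"

lemma gluings_correct:
  assumes "(x, y, b) \<in> gluings n"
  shows "x \<in> states n \<and> y \<in> states n \<and> b \<noteq> x \<and> (\<exists>i. b = (next_state n ^^ i) x) \<and>
    (next_state n x, next_state n b) \<in> raise_rel \<and> (b, y) \<in> raise_rel \<and> (next_state n y, x) \<in> raise_rel"
proof -
  obtain u v where 1: "x = (Arch (Arch Nul u) v, 0, False)" "y = (Arch Nul (Arch u v), 0, False)"
    "b = (Arch (u \<star> Arch v Nul) Nul, 2 * n - 1, True)" "Suc (Suc (semilength u + semilength v)) = n"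
    using assms unfolding gluings_def by blast
  let ?N = "2 * n + 1"
  have n: "2 * n = 4 + length (word u) + length (word v)" using 1(4) by simp
  \<comment> \<open>Two rotations lead from the word of \<open>x\<close> to that of \<open>b\<close>
    and lower the position from 0 to -2, which is \<open>2 * n - 1\<close> modulo
    \<open>2 * n + 1\<close>.\<close>
  have "(rot ^^ 2) (Arch (Arch Nul u) v) = Arch (u \<star> Arch v Nul) Nul"
    by (simp add: numeral_2_eq_2)
  then obtain k where "(next_state n ^^ k) x = (Arch (u \<star> Arch v Nul) Nul, 2 * n - 1, False)"
    using next_state_orbit[of "Arch (Arch Nul u) v" n 0 "2 * n - 1" 2] 1 by auto
  then have orbit: "(next_state n ^^ Suc k) x = b" using 1 by simp
  have x: "label x = [True, True, False] @ word u @ False # word v @ [False]"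
    using 1 by simp
  have fx: "label (next_state n x) = [True, True, False] @ word u @ True # word v @ [False]"
    using 1 by simp
  have y: "label y = [True, False, True] @ word u @ False # word v @ [False]"
    using 1 by simp
  have fy: "label (next_state n y) = [True, True, True] @ word u @ False # word v @ [False]"
    using 1 by simp
  have b: "label b = [True, False, True] @ word u @ True # word v @ [False]"
  proof -
    let ?w = "True # word u @ True # word v @ [False]"
    have "label b = rotate (2 * n - 1) (?w @ [True, False])" using 1 by simp
    also have "2 * n - 1 = length ?w" using n by simp
    finally show ?thesis by (simp only: rotate_append) simp
  qed
  have fb: "label (next_state n b) = [True, False, False] @ word u @ True # word v @ [False]"
  proof -
    let ?w = "word u @ True # word v @ [False]"
    have "(2 * n - 1 + 2 * n) mod ?N = 2 * n - 2"
    proof -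
      have "2 * n - 1 + 2 * n = (2 * n - 2) + ?N" using n by simp
      then show ?thesis using n by (simp only: mod_add_self2) simp
    qed
    then have "label (next_state n b) = rotate (2 * n - 2) (?w @ [True, False, False])" using 1 by simp
    also have "2 * n - 2 = length ?w" using n by simp
    finally show ?thesis by (simp only: rotate_append)
  qed
  \<comment> \<open>These three bit flips close the 6-cycle whose other edges join \<open>x\<close>,
    \<open>b\<close> and \<open>y\<close> to their successors.\<close>
  have "raise (label (next_state n b)) (label (next_state n x))"
    unfolding fx fb using raiseI[of "[True]" "False # word u @ True # word v @ [False]"] by simp
  moreover have "raise (label y) (label b)"
    unfolding y b using raiseI[of "[True, False, True] @ word u" "word v @ [False]"] by simp
  moreover have "raise (label x) (label (next_state n y))"
    unfolding x fy using raiseI[of "[True, True]" "word u @ False # word v @ [False]"] by simp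
  moreover have "x \<in> states n" "y \<in> states n" "b \<noteq> x" using 1 by (auto simp: states_def)
  ultimately show ?thesis unfolding raise_rel_def using orbit[symmetric] by blast
qed

text \<open>Rotations are realised within an orbit and pulls by gluings, so
  \<open>moves_to_star\<close> carries over; a state on the upper level first takes one step
  down.\<close>

lemma states_reach_star:
  assumes "s \<in> states n" "0 < n"
  shows "(s, (star n, 0, False)) \<in> ({(v, next_state n v) |v. v \<in> states n} \<union> {(x, y). \<exists>b. (x, y, b) \<in> gluings n})\<^sup>*"
    (is "_ \<in> ?R\<^sup>*")
proof -
  have funpow: "(s, (next_state n ^^ k) s) \<in> ?R\<^sup>*" if "s \<in> states n" for s k
  proof -
    have "(next_state n ^^ k) s \<in> states n \<and> (s, (next_state n ^^ k) s) \<in> ?R\<^sup>*"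
    proof (induction k)
      case (Suc k)
      then have "((next_state n ^^ k) s, (next_state n ^^ Suc k) s) \<in> ?R"
        unfolding funpow.simps comp_apply by blast
      then show ?case using Suc next_state_in by (auto intro: rtrancl_into_rtrancl)
    qed (use that in simp)
    then show ?thesis by blast
  qed
  have orbit: "((t, i, False), ((rot ^^ m) t, j, False)) \<in> ?R\<^sup>*"
    if "semilength t = n" "i < 2 * n + 1" "j < 2 * n + 1" for t i j m
  proof -
    have "(t, i, False) \<in> states n" using that by (simp add: states_def)
    moreover from next_state_orbit[OF that] obtain k
      where "(next_state n ^^ k) (t, i, False) = ((rot ^^ m) t, j, False)" by blast
    ultimately show ?thesis using funpow[of "(t, i, False)" k] by metis
  qed
  have main: "((t, 0, False), (t', 0, False)) \<in> ?R\<^sup>*" if "(t, t') \<in> moves\<^sup>*" "semilength t = n" for t t'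
    using that
  proof (induction rule: rtrancl_induct)
    case (step p q)
    have p: "semilength p = n" using moves_semilength[OF step(1)] step.prems by simp
    have "((p, 0, False), (q, 0, False)) \<in> ?R\<^sup>*"
      using step(2)
    proof (cases rule: moves.cases)
      case rot
      then show ?thesis using orbit[OF p, of 0 0 1] by simp
    next
      case (pull u v)
      then have "Suc (Suc (semilength u + semilength v)) = n" using p by simp
      then have "((p, 0, False), (q, 0, False)) \<in> ?R" using pull unfolding gluings_def by blast
      then show ?thesis by blast
    qed
    then show ?case using step by auto
  qed simp
  have F: "((t, i, False), (star n, 0, False)) \<in> ?R\<^sup>*" if "semilength t = n" "i < 2 * n + 1" for t i
  proof -
    have "((t, i, False), (t, 0, False)) \<in> ?R\<^sup>*" using orbit[OF that, of 0 0] by simp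
    moreover have "((t, 0, False), (star n, 0, False)) \<in> ?R\<^sup>*"
      using main[OF _ that(1)] moves_to_star[of t 0] that(1) by simp
    ultimately show ?thesis by simp
  qed
  show ?thesis
  proof (cases s rule: label.cases)
    case (1 t i)
    then show ?thesis using F assms by (simp add: states_def)
  next
    case (2 t i)
    have "(s, next_state n s) \<in> ?R" using assms by blast
    moreover have "(next_state n s, (star n, 0, False)) \<in> ?R\<^sup>*"
      using 2 F assms by (simp add: states_def)
    ultimately show ?thesis by (rule converse_rtrancl_into_rtrancl)
  qed
qed

theorem states_hamilton_cycle:
  assumes "0 < n"
  shows "\<exists>vs. vs \<noteq> [] \<and> distinct vs \<and> set vs = states n \<and> cycle_arcs vs \<subseteq> raise_rel"
proof (rule hamilton_cycle_by_gluing_orbits[where f = "next_state n" and G = "gluings n"])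
  show "(star n, 0, False) \<in> states n" by (simp add: states_def)
  show "next_state n ` states n \<subseteq> states n" using next_state_in by auto
next
  \<comment> \<open>\<open>y\<close> determines \<open>u\<close> and \<open>v\<close>, hence the
    whole triple.\<close>
  fix x y b x' b' assume "(x, y, b) \<in> gluings n" "(x', y, b') \<in> gluings n"
  then show "x = x'" unfolding gluings_def by blast
next
  \<comment> \<open>The tree of \<open>y'\<close> has a leaf as first child of the root, that of
    \<open>x\<close> does not, and \<open>b\<close> lies on the upper level.\<close>
  fix x y b x' y' b' assume "(x, y, b) \<in> gluings n" "(x', y', b') \<in> gluings n"
  then show "x \<noteq> y' \<and> b \<noteq> y'" unfolding gluings_def by auto
next
  fix s assume "s \<in> states n"
  then show "(s, (star n, 0, False)) \<in> ({(v, next_state n v) |v. v \<in> states n}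
      \<union> {(x, y). \<exists>b. (x, y, b) \<in> gluings n})\<^sup>*"
    using assms by (rule states_reach_star)
qed (use assms in \<open>blast intro: finite_states inj_on_next_state sym_raise_rel next_state_raise
  dest: next_state_two gluings_correct\<close>)+

section \<open>Saturating cycles between consecutive levels\<close>

definition inclusion_rel :: "(nat set \<times> nat set) set" where
  "inclusion_rel = {(A, B). (\<exists>a. a \<notin> A \<and> B = insert a A) \<or> (\<exists>a. a \<notin> B \<and> A = insert a B)}"

definition saturating_cycle :: "nat set \<Rightarrow> nat \<Rightarrow> nat set list \<Rightarrow> bool" where
  "saturating_cycle U j vs \<longleftrightarrow> vs \<noteq> [] \<and> distinct vs \<and> cycle_arcs vs \<subseteq> inclusion_rel \<and>
    (\<forall>A \<in> set vs. A \<subseteq> U \<and> (card A = j \<or> card A = Suc j)) \<and> (\<forall>A. A \<subseteq> U \<longrightarrow> card A = j \<longrightarrow> A \<in> set vs)"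

lemma inclusion_relI: "a \<notin> A \<Longrightarrow> (A, insert a A) \<in> inclusion_rel" "a \<notin> A \<Longrightarrow> (insert a A, A) \<in> inclusion_rel"
  by (auto simp: inclusion_rel_def)

lemma inclusion_rel_card:
  assumes "(A, B) \<in> inclusion_rel" "finite A" "finite B" "card A = j"
  shows "card B = Suc j \<and> (\<exists>a. a \<notin> A \<and> B = insert a A) \<or> Suc (card B) = j"
  using assms by (auto simp: inclusion_rel_def)

lemma inclusion_rel_image:
  assumes "(A, B) \<in> inclusion_rel" "inj_on p U" "A \<subseteq> U" "B \<subseteq> U"
  shows "(p ` A, p ` B) \<in> inclusion_rel"
proof -
  have "p a \<notin> p ` X" if "a \<notin> X" "insert a X \<subseteq> U" for a X
    using that assms(2) by (auto dest: inj_onD)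
  then have insert: "\<exists>b. b \<notin> p ` X \<and> p ` insert a X = insert b (p ` X)" if "a \<notin> X" "insert a X \<subseteq> U" for a X
    using that by auto
  from assms(1) consider a where "a \<notin> A" "B = insert a A" | a where "a \<notin> B" "A = insert a B"
    unfolding inclusion_rel_def by blast
  then show ?thesis
  proof cases
    case 1
    then show ?thesis using insert[of a A] assms(4) unfolding inclusion_rel_def by blast
  next
    case 2
    then show ?thesis using insert[of a B] assms(3) unfolding inclusion_rel_def by blast
  qed
qed

lemma cycle_arcs_subset: "vs \<noteq> [] \<Longrightarrow> cycle_arcs vs \<subseteq> set vs \<times> set vs"
  using path_arcs_subset[of vs] by (auto simp: cycle_arcs_def)

section \<open>Bit strings as sets\<close>

definition ones :: "bool list \<Rightarrow> nat set" where
  "ones w = {i. i < length w \<and> w ! i}"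

lemma ones_append: "ones (p @ c # q) = ones p \<union> (if c then {length p} else {}) \<union> (\<lambda>i. length p + Suc i) ` ones q"
proof -
  have "i \<in> ones (p @ c # q) \<longleftrightarrow> i \<in> ones p \<union> (if c then {length p} else {}) \<union> (\<lambda>i. length p + Suc i) ` ones q" for i
  proof -
    consider "i < length p" | "i = length p" | k where "i = length p + Suc k"
      by (metis less_imp_Suc_add linorder_neqE_nat add_Suc_right)
    then show ?thesis by cases (auto simp: ones_def nth_append)
  qed
  then show ?thesis by blast
qed

lemma raise_ones: "raise v w \<Longrightarrow> \<exists>a. a \<notin> ones v \<and> ones w = insert a (ones v)"
proof -
  assume "raise v w"
  then obtain p q where vw: "v = p @ False # q" "w = p @ True # q" unfolding raise_def by blast
  have "length p \<notin> ones v" unfolding vw by (simp add: ones_def)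
  moreover have "ones w = insert (length p) (ones v)" unfolding vw ones_append by auto
  ultimately show ?thesis by blast
qed

lemma height_ones: "height w = 2 * int (card (ones w)) - int (length w)"
proof -
  have "height w = 2 * int (length (filter id w)) - int (length w)" by (induction w) auto
  then show ?thesis by (simp add: length_filter_conv_card ones_def)
qed

lemma ones_inject: "length v = length w \<Longrightarrow> ones v = ones w \<Longrightarrow> v = w"
  by (rule nth_equalityI) (auto simp: ones_def set_eq_iff)

lemma ones_indicator: "A \<subseteq> {..<N} \<Longrightarrow> ones (map (\<lambda>i. i \<in> A) [0..<N]) = A"
  by (auto simp: ones_def)

text \<open>Transports the Hamilton cycle of the states along \<open>ones\<close>. Sets of size
  \<open>n\<close> are the words of height -1, for which the cycle lemma supplies a state.\<close>

theorem middle_levels: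
  assumes "0 < n"
  shows "\<exists>vs. saturating_cycle {..<2 * n + 1} n vs"
proof -
  obtain ss where ss: "ss \<noteq> []" "distinct ss" "set ss = states n" "cycle_arcs ss \<subseteq> raise_rel"
    using states_hamilton_cycle[OF assms] by blast
  define g where "g s = ones (label s)" for s
  have card: "card (g s) = n \<or> card (g s) = Suc n" if "s \<in> states n" for s
  proof -
    obtain t i c where s: "s = (t, i, c)" by (cases s)
    have "2 * int (card (g s)) = int (2 * n + 1) + (if c then 1 else - 1)"
      using height_ones[of "label s"] height_label[of t i c] length_label[OF that] by (simp add: g_def s)
    then show ?thesis by (auto split: if_splits)
  qed
  have "saturating_cycle {..<2 * n + 1} n (map g ss)"
    unfolding saturating_cycle_def
  proof (intro conjI ballI allI impI)
    show "map g ss \<noteq> []" using ss by simp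
    have "inj_on g (states n)"
    proof (rule inj_onI)
      fix s t assume st: "s \<in> states n" "t \<in> states n" "g s = g t"
      then have "label s = label t" by (intro ones_inject) (auto simp: g_def length_label)
      then show "s = t" using inj_onD[OF inj_on_label] st by blast
    qed
    then show "distinct (map g ss)" using ss by (simp add: distinct_map)
    show "cycle_arcs (map g ss) \<subseteq> inclusion_rel"
      unfolding cycle_arcs_map[OF ss(1)]
    proof
      fix e assume "e \<in> map_prod g g ` cycle_arcs ss"
      then obtain s t where "e = (g s, g t)" "(s, t) \<in> raise_rel" using ss(4) by auto
      then show "e \<in> inclusion_rel"
        using raise_ones unfolding raise_rel_def inclusion_rel_def g_def by blast
    qed
  next
    fix A assume "A \<in> set (map g ss)"
    then obtain s where s: "s \<in> states n" "A = g s" using ss(3) by auto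
    then show "A \<subseteq> {..<2 * n + 1}" using length_label[of s n] by (auto simp: g_def ones_def)
    show "card A = n \<or> card A = Suc n" using card s by blast
  next
    fix A :: "nat set" assume A: "A \<subseteq> {..<2 * n + 1}" "card A = n"
    let ?w = "map (\<lambda>i. i \<in> A) [0..<2 * n + 1]"
    have w: "ones ?w = A" using ones_indicator[OF A(1)] .
    have "length ?w = 2 * n + 1" by simp
    moreover from this have "height ?w = - 1" unfolding height_ones w using A(2) by simp
    ultimately have "?w \<in> label ` states n" by (rule label_surj)
    then obtain s where "s \<in> states n" "?w = label s" by blast
    then have "A = g s" "s \<in> set ss" using w ss(3) by (simp_all add: g_def)
    then show "A \<in> set (map g ss)" by simp
  qed
  then show ?thesis by blast
qed

section \<open>Counting along alternating cycles\<close>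

lemma alternating_count:
  assumes "vs \<noteq> []" "\<And>a b. (a, b) \<in> path_arcs vs \<Longrightarrow> P a \<noteq> P b"
  shows "int (length (filter P vs)) - int (length (filter (\<lambda>v. \<not> P v) vs))
    = of_bool (P (hd vs)) + of_bool (P (last vs)) - 1"
  using assms
proof (induction vs rule: path_arcs.induct)
  case (3 x y zs)
  have "P x \<noteq> P y" using 3(3) by auto
  then show ?case using 3 by auto
qed auto

lemma alternating_cycle_card:
  assumes "vs \<noteq> []" "distinct vs" "\<And>a b. (a, b) \<in> cycle_arcs vs \<Longrightarrow> P a \<noteq> P b"
  shows "card {v \<in> set vs. P v} = card {v \<in> set vs. \<not> P v}"
proof -
  have "P (last vs) \<noteq> P (hd vs)" using assms(3) by (auto simp: cycle_arcs_def)
  then have "int (length (filter P vs)) = int (length (filter (\<lambda>v. \<not> P v) vs))"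
    using alternating_count[of vs P] assms by (fastforce simp: cycle_arcs_def of_bool_def split: if_splits)
  moreover have "card {v \<in> set vs. Q v} = length (filter Q vs)" for Q
    using distinct_card[of "filter Q vs"] assms(2) by simp
  ultimately show ?thesis by simp
qed

text \<open>Sizes alternate along the cycle, so it visits as many sets of size \<open>Suc j\<close>
  as of size \<open>j\<close>, and it visits all of the latter.\<close>

lemma saturating_cycle_card:
  assumes "saturating_cycle U j vs" "finite U"
  shows "card {A \<in> set vs. card A = j} = card U choose j" "card {A \<in> set vs. card A \<noteq> j} = card U choose j"
proof -
  have "{A \<in> set vs. card A = j} = {A. A \<subseteq> U \<and> card A = j}"
    using assms(1) by (auto simp: saturating_cycle_def)
  then show 1: "card {A \<in> set vs. card A = j} = card U choose j" using n_subsets[OF assms(2)] by simp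
  have "card {A \<in> set vs. card A = j} = card {A \<in> set vs. card A \<noteq> j}"
  proof (rule alternating_cycle_card)
    fix A B assume AB: "(A, B) \<in> cycle_arcs vs"
    have vs: "vs \<noteq> []" "cycle_arcs vs \<subseteq> inclusion_rel"
      using assms(1) by (auto simp: saturating_cycle_def)
    have sub: "C \<subseteq> U" "card C = j \<or> card C = Suc j" if "C \<in> set vs" for C
      using assms(1) that by (auto simp: saturating_cycle_def)
    have "A \<in> set vs" "B \<in> set vs" using AB cycle_arcs_subset[OF vs(1)] by auto
    moreover have "(A, B) \<in> inclusion_rel" using AB vs by blast
    moreover have "finite A" "finite B"
      using sub(1) \<open>A \<in> set vs\<close> \<open>B \<in> set vs\<close> assms(2) by (meson finite_subset)+
    ultimately show "(card A = j) \<noteq> (card B = j)"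
      using inclusion_rel_card[of A B "card A"] sub(2)[of A] sub(2)[of B] by auto
  qed (use assms(1) in \<open>auto simp: saturating_cycle_def\<close>)
  then show "card {A \<in> set vs. card A \<noteq> j} = card U choose j" using 1 by simp
qed

text \<open>The four regions that \<open>A\<close> and \<open>B\<close> cut out of \<open>U\<close>
  are as large as those of \<open>A'\<close> and \<open>B'\<close>, so bijections between them
  combine to \<open>p\<close>.\<close>

lemma bij_betw_two_subsets:
  assumes "finite U" "A \<subseteq> U" "B \<subseteq> U" "A' \<subseteq> U" "B' \<subseteq> U"
    and "card A = card A'" "card B = card B'" "card (A \<inter> B) = card (A' \<inter> B')"
  shows "\<exists>p. bij_betw p U U \<and> p ` A = A' \<and> p ` B = B'"
proof -
  have fin: "finite A" "finite B" "finite A'" "finite B'" using assms by (auto intro: finite_subset)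
  have c1: "card (A - B) = card (A' - B')" "card (B - A) = card (B' - A')"
    using assms fin by (simp_all add: card_Diff_subset_Int Int_commute)
  have c2: "card (A \<union> B) = card (A' \<union> B')"
    using card_Un_Int[of A B] card_Un_Int[of A' B'] assms fin by simp
  then have c3: "card (U - (A \<union> B)) = card (U - (A' \<union> B'))"
    using assms fin by (simp add: card_Diff_subset)
  obtain h1 where h1: "bij_betw h1 (A \<inter> B) (A' \<inter> B')"
    using finite_same_card_bij assms(8) fin by (metis finite_Int)
  obtain h2 where h2: "bij_betw h2 (A - B) (A' - B')"
    using finite_same_card_bij c1(1) fin by (metis finite_Diff)
  obtain h3 where h3: "bij_betw h3 (B - A) (B' - A')"
    using finite_same_card_bij c1(2) fin by (metis finite_Diff)
  obtain h4 where h4: "bij_betw h4 (U - (A \<union> B)) (U - (A' \<union> B'))"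
    using finite_same_card_bij c3 assms(1) by (metis finite_Diff)
  define p where "p a = (if a \<in> A then if a \<in> B then h1 a else h2 a else if a \<in> B then h3 a else h4 a)" for a
  have im: "p ` (A \<inter> B) = A' \<inter> B'" "p ` (A - B) = A' - B'" "p ` (B - A) = B' - A'"
    "p ` (U - (A \<union> B)) = U - (A' \<union> B')"
    using h1 h2 h3 h4 by (auto simp: p_def bij_betw_def image_iff cong: image_cong)
  have "p ` A = p ` (A \<inter> B) \<union> p ` (A - B)" by blast
  then have A: "p ` A = A'" using im by auto
  have "p ` B = p ` (A \<inter> B) \<union> p ` (B - A)" by blast
  then have B: "p ` B = B'" using im by auto
  have "U = A \<union> B \<union> (U - (A \<union> B))" using assms by blast
  then have "p ` U = p ` A \<union> p ` B \<union> p ` (U - (A \<union> B))" by (metis image_Un)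
  then have "p ` U = U" using A B im assms by auto
  then have "bij_betw p U U" using assms(1) by (simp add: bij_betw_def eq_card_imp_inj_on)
  then show ?thesis using A B by blast
qed

section \<open>Relabelling and adding a coordinate\<close>

lemma saturating_cycle_image:
  assumes "saturating_cycle U j vs" "bij_betw p U U" "finite U"
  shows "saturating_cycle U j (map ((`) p) vs)"
proof -
  have vs: "vs \<noteq> []" "distinct vs" "cycle_arcs vs \<subseteq> inclusion_rel"
    and sub: "\<And>A. A \<in> set vs \<Longrightarrow> A \<subseteq> U \<and> (card A = j \<or> card A = Suc j)"
    and sat: "\<And>A. A \<subseteq> U \<Longrightarrow> card A = j \<Longrightarrow> A \<in> set vs"
    using assms(1) unfolding saturating_cycle_def by blast+
  have inj: "inj_on p U" and im: "p ` U = U" using assms(2) by (auto simp: bij_betw_def)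
  show ?thesis
    unfolding saturating_cycle_def
  proof (intro conjI ballI allI impI)
    have "inj_on ((`) p) (set vs)"
      using inj_on_image_Pow[OF inj] by (rule inj_on_subset) (use sub in auto)
    then show "distinct (map ((`) p) vs)" using vs by (simp add: distinct_map)
    show "cycle_arcs (map ((`) p) vs) \<subseteq> inclusion_rel"
      unfolding cycle_arcs_map[OF vs(1)]
    proof
      fix e assume "e \<in> map_prod ((`) p) ((`) p) ` cycle_arcs vs"
      then obtain A B where AB: "e = (p ` A, p ` B)" "(A, B) \<in> cycle_arcs vs" by auto
      then have "A \<subseteq> U" "B \<subseteq> U" using cycle_arcs_subset[OF vs(1)] sub by blast+
      then show "e \<in> inclusion_rel" using inclusion_rel_image[OF _ inj] AB vs(3) by blast
    qed
  next
    fix A assume "A \<in> set (map ((`) p) vs)"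
    then obtain B where B: "A = p ` B" "B \<in> set vs" by auto
    then show "A \<subseteq> U" using sub im by blast
    have "card A = card B" using B sub inj by (metis card_image inj_on_subset)
    then show "card A = j \<or> card A = Suc j" using B sub by auto
  next
    fix A assume A: "A \<subseteq> U" "card A = j"
    then obtain B where B: "B \<subseteq> U" "A = p ` B" using im by (metis subset_imageE)
    then have "card B = j" using A inj by (metis card_image inj_on_subset)
    then show "A \<in> set (map ((`) p) vs)" using B sat by auto
  qed (use vs in simp)
qed

text \<open>\<open>D\<close> with \<open>m\<close> added to every set accounts for the sets
  containing \<open>m\<close>, and \<open>C\<close> for the others. Let \<open>x'\<close> be a set
  that \<open>D\<close> misses, and let \<open>x\<close> follow \<open>p = x' - {c}\<close> on
  \<open>D\<close>. Relabel \<open>C\<close> so that \<open>x\<close> and \<open>x'\<close> have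
  only one set between them. That set has size \<open>i + 2\<close>, so it may be dropped; the path
  \<open>insert m x\<close>, ..., \<open>insert m p\<close>, \<open>insert m x'\<close> takes its
  place.\<close>

theorem saturating_cycle_step:
  assumes C: "saturating_cycle {..<m} (Suc i) C" and D: "saturating_cycle {..<m} i D"
    and m: "2 * i + 2 \<le> m"
  shows "\<exists>vs. saturating_cycle {..<Suc m} (Suc i) vs"
proof -
  let ?U = "{..<m}"
  have Cvs: "C \<noteq> []" "distinct C" "cycle_arcs C \<subseteq> inclusion_rel"
    and Csub: "\<And>A. A \<in> set C \<Longrightarrow> A \<subseteq> ?U \<and> (card A = Suc i \<or> card A = Suc (Suc i))"
    and Csat: "\<And>A. A \<subseteq> ?U \<Longrightarrow> card A = Suc i \<Longrightarrow> A \<in> set C"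
    using C unfolding saturating_cycle_def by blast+
  have Dvs: "D \<noteq> []" "distinct D" "cycle_arcs D \<subseteq> inclusion_rel"
    and Dsub: "\<And>A. A \<in> set D \<Longrightarrow> A \<subseteq> ?U \<and> (card A = i \<or> card A = Suc i)"
    and Dsat: "\<And>A. A \<subseteq> ?U \<Longrightarrow> card A = i \<Longrightarrow> A \<in> set D"
    using D unfolding saturating_cycle_def by blast+
  have fin: "finite A" if "A \<subseteq> ?U" for A using that by (rule finite_subset) simp
  \<comment> \<open>\<open>D\<close> visits only \<open>m choose i\<close> sets of size
    \<open>Suc i\<close>, and \<open>2 * i + 2 \<le> m\<close> makes this too few.\<close>
  have "\<exists>x'. x' \<subseteq> ?U \<and> card x' = Suc i \<and> x' \<notin> set D"
  proof (rule ccontr)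
    assume "\<not> ?thesis"
    then have "{A. A \<subseteq> ?U \<and> card A = Suc i} \<subseteq> {A \<in> set D. card A \<noteq> i}" by auto
    then have "card {A. A \<subseteq> ?U \<and> card A = Suc i} \<le> card {A \<in> set D. card A \<noteq> i}"
      by (intro card_mono) auto
    then have "m choose Suc i \<le> m choose i"
      using saturating_cycle_card(2)[OF D] n_subsets[of ?U "Suc i"] by simp
    moreover have "m choose i < m choose Suc i" using m by (intro binomial_strict_mono) auto
    ultimately show False by simp
  qed
  then obtain x' where x': "x' \<subseteq> ?U" "card x' = Suc i" "x' \<notin> set D" by blast
  then obtain c where c: "c \<in> x'" by (metis card_gt_0_iff ex_in_conv zero_less_Suc)
  define p where "p = x' - {c}"
  have p: "p \<subseteq> ?U" "card p = i" "x' = insert c p" "c \<notin> p"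
    using x' c fin[OF x'(1)] by (auto simp: p_def)
  obtain D' where D': "distinct D'" "set D' = set D" "cycle_arcs D' = cycle_arcs D" "D' \<noteq> []" "last D' = p"
    using cycle_arcs_rotate_last[OF Dsat[OF p(1,2)] Dvs(2)] by blast
  define x where "x = hd D'"
  have D'arcs: "cycle_arcs D' \<subseteq> inclusion_rel" using D'(3) Dvs(3) by simp
  then have px: "(p, x) \<in> inclusion_rel" using D'(5) by (auto simp: x_def cycle_arcs_def)
  have xD: "x \<in> set D" using D' by (metis hd_in_set x_def)
  then have xU: "x \<subseteq> ?U" using Dsub by blast
  have "card x = Suc i \<and> (\<exists>a. a \<notin> p \<and> x = insert a p)"
    using inclusion_rel_card[OF px fin[OF p(1)] fin[OF xU] p(2)] Dsub[OF xD] by auto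
  then obtain a where x: "card x = Suc i" "a \<notin> p" "x = insert a p" by blast
  have "x \<noteq> x'" using xD x'(3) by auto
  then have xx': "x \<inter> x' = p" using x p by auto
  \<comment> \<open>Any set of size \<open>Suc i\<close> would serve; it and the second set after it
    on \<open>C\<close> are relabelled to \<open>x\<close> and \<open>x'\<close>.\<close>
  have "{..<Suc i} \<in> set C" using m by (intro Csat) auto
  then obtain C' where C': "distinct C'" "set C' = set C" "cycle_arcs C' = cycle_arcs C" "C' \<noteq> []" "last C' = {..<Suc i}"
    using cycle_arcs_rotate_last[OF _ Cvs(2)] by metis
  define x1 where "x1 = {..<Suc i}"
  have x1: "card x1 = Suc i" "x1 \<subseteq> ?U" using m by (auto simp: x1_def)
  obtain y R where yR: "C' = y # R" using C'(4) by (cases C') auto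
  have yC: "y \<in> set C" using C'(2) yR by auto
  have C'arcs: "cycle_arcs C' \<subseteq> inclusion_rel" using C'(3) Cvs(3) by simp
  then have "(x1, y) \<in> inclusion_rel" using C'(5) yR by (auto simp: x1_def cycle_arcs_def)
  then have y: "card y = Suc (Suc i)" "x1 \<subseteq> y"
    using inclusion_rel_card[of x1 y "Suc i"] x1 fin Csub[OF yC] by auto
  have "R \<noteq> []"
  proof
    assume "R = []"
    then have "y = x1" using C'(5) yR by (simp add: x1_def)
    then show False using y(1) x1(1) by simp
  qed
  then obtain x1' R' where R: "R = x1' # R'" by (cases R) auto
  have x1'C: "x1' \<in> set C" using C'(2) yR R by auto
  have "(y, x1') \<in> inclusion_rel" using C'arcs yR R by (auto simp: cycle_arcs_def)
  then have x1': "card x1' = Suc i" "x1' \<subseteq> y" "x1' \<subseteq> ?U"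
    using Csub[OF x1'C] Csub[OF yC] y(1) fin by (auto simp: inclusion_rel_def)
  \<comment> \<open>Otherwise \<open>C\<close> would be a single edge, but it visits both
    \<open>x\<close> and \<open>x'\<close>.\<close>
  have "x1 \<noteq> x1'"
  proof
    assume "x1 = x1'"
    then have "last (x1' # R') = x1'" using C'(5) yR R by (simp add: x1_def)
    then have "R' = []" using C'(1) yR R by (cases R' rule: rev_cases) auto
    then have "set C = {y, x1'}" using C'(2) yR R by auto
    moreover have "x \<in> set C" "x' \<in> set C" using Csat x xU x' by auto
    ultimately show False using \<open>x \<noteq> x'\<close> y(1) x(1) x'(2) by auto
  qed
  have card_x1: "card (x1 \<inter> x1') = i"
  proof -
    have "finite y" using Csub[OF yC] fin by blast
    then have "card (x1 \<union> x1') \<le> Suc (Suc i)" using card_mono[of y "x1 \<union> x1'"] y x1' by auto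
    moreover have "card (x1 \<union> x1') + card (x1 \<inter> x1') = Suc i + Suc i"
      using card_Un_Int[of x1 x1'] x1 x1' fin by simp
    moreover have "card (x1 \<inter> x1') < Suc i"
    proof -
      have "\<not> x1 \<subseteq> x1'" using \<open>x1 \<noteq> x1'\<close> x1(1) x1' fin[OF x1'(3)] card_subset_eq by metis
      then have "x1 \<inter> x1' \<subset> x1" by blast
      then show ?thesis using psubset_card_mono[of x1] fin[OF x1(2)] x1(1) by metis
    qed
    ultimately show ?thesis by simp
  qed
  \<comment> \<open>Both pairs consist of sets of size \<open>Suc i\<close> that meet in
    \<open>i\<close> elements.\<close>
  have "\<exists>g. bij_betw g ?U ?U \<and> g ` x1 = x \<and> g ` x1' = x'"
    by (rule bij_betw_two_subsets) (simp_all only: finite_lessThan x1 x1' x(1) xU x'(1,2) xx' p(2) card_x1)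
  then obtain g where g: "bij_betw g ?U ?U" "g ` x1 = x" "g ` x1' = x'" by blast
  have "saturating_cycle ?U (Suc i) C'" using C C' by (simp add: saturating_cycle_def)
  then have "saturating_cycle ?U (Suc i) (map ((`) g) C')" using g by (intro saturating_cycle_image) auto
  moreover define Q where "Q = map ((`) g) R"
  ultimately have Q: "saturating_cycle ?U (Suc i) (g ` y # Q)" by (simp add: yR)
  have Q1: "Q \<noteq> []" "hd Q = x'" using R g by (auto simp: Q_def)
  have "last R = x1" using C'(5) yR \<open>R \<noteq> []\<close> by (simp add: x1_def)
  then have Q2: "last Q = x" using g \<open>R \<noteq> []\<close> by (simp add: Q_def last_map)
  have Qarcs: "path_arcs Q \<subseteq> inclusion_rel" "distinct Q"
    using Q Q1 by (cases Q; auto simp: saturating_cycle_def cycle_arcs_def)+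
  have Qsub: "A \<subseteq> ?U" "card A = Suc i \<or> card A = Suc (Suc i)" if "A \<in> set Q" for A
    using Q that by (auto simp: saturating_cycle_def)
  have "card (g ` y) = Suc (Suc i)"
    using y(1) Csub[OF yC] g(1) by (metis bij_betw_def card_image inj_on_subset)
  then have Qsat: "A \<in> set Q" if "A \<subseteq> ?U" "card A = Suc i" for A
    using Q that by (auto simp: saturating_cycle_def)
  define vs where "vs = (map (insert m) D' @ [insert m x']) @ Q"
  have mU: "m \<notin> A" if "A \<subseteq> ?U" for A using that by auto
  have D'sub: "A \<subseteq> ?U" "card A = i \<or> card A = Suc i" if "A \<in> set D'" for A
    using that D'(2) Dsub by auto
  have inj: "inj_on (insert m) (Pow ?U)"
    by (rule inj_onI) (metis PowD mU insert_ident)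
  have arcsD: "path_arcs (map (insert m) D') \<subseteq> inclusion_rel"
    unfolding path_arcs_map
  proof
    fix e assume "e \<in> map_prod (insert m) (insert m) ` path_arcs D'"
    then obtain A B where AB: "e = (insert m A, insert m B)" "(A, B) \<in> path_arcs D'" by auto
    then have "A \<subseteq> ?U" "B \<subseteq> ?U" using path_arcs_subset[of D'] D'sub by blast+
    moreover have "(A, B) \<in> inclusion_rel" using AB D'arcs by (auto simp: cycle_arcs_def)
    ultimately show "e \<in> inclusion_rel" using AB(1) unfolding inclusion_rel_def
      by (auto simp: insert_commute)
  qed
  have arcs: "cycle_arcs vs \<subseteq> inclusion_rel"
  proof -
    have "(insert m p, insert m x') \<in> inclusion_rel"
      using inclusion_relI(1)[of c "insert m p"] p c x'(1) by (auto simp: insert_commute)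
    moreover have "(insert m x', x') \<in> inclusion_rel" "(x, insert m x) \<in> inclusion_rel"
      using inclusion_relI mU x'(1) xU by auto
    moreover have "hd (map (insert m) D' @ [insert m x']) = insert m x" using D'(4) by (simp add: x_def hd_map)
    ultimately show ?thesis
      unfolding vs_def using arcsD Qarcs D' Q1 Q2
      by (subst cycle_arcs_append) (auto simp: path_arcs_append last_map)
  qed
  have "saturating_cycle {..<Suc m} (Suc i) vs"
    unfolding saturating_cycle_def
  proof (intro conjI ballI allI impI)
    show "vs \<noteq> []" by (simp add: vs_def)
    have "distinct (map (insert m) D')"
      using D'(1) inj_on_subset[OF inj, of "set D'"] D'sub by (auto simp: distinct_map)
    moreover have "insert m x' \<notin> insert m ` set D'"
    proof
      assume "insert m x' \<in> insert m ` set D'"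
      then obtain A where A: "A \<in> set D'" "insert m x' = insert m A" by blast
      then have "x' = A" using inj_onD[OF inj A(2)] x'(1) D'sub(1) by blast
      then show False using A(1) x'(3) D'(2) by blast
    qed
    moreover have "insert m A \<notin> set Q" for A using Qsub(1)[of "insert m A"] by auto
    ultimately show "distinct vs" using Qarcs(2) by (auto simp: vs_def)
    show "cycle_arcs vs \<subseteq> inclusion_rel" by (rule arcs)
  next
    fix A assume "A \<in> set vs"
    then consider B where "A = insert m B" "B \<in> set D'" | "A = insert m x'" | "A \<in> set Q"
      by (auto simp: vs_def)
    then have "A \<subseteq> {..<Suc m} \<and> (card A = Suc i \<or> card A = Suc (Suc i))"
    proof cases
      case 1
      then show ?thesis using D'sub[of B] mU[of B] fin[of B] by auto
    next
      case 2
      then show ?thesis using x' mU[of x'] fin[of x'] by auto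
    next
      case 3
      then show ?thesis using Qsub[of A] by auto
    qed
    then show "A \<subseteq> {..<Suc m}" "card A = Suc i \<or> card A = Suc (Suc i)" by auto
  next
    fix A assume A: "A \<subseteq> {..<Suc m}" "card A = Suc i"
    show "A \<in> set vs"
    proof (cases "m \<in> A")
      case True
      then have "A - {m} \<subseteq> ?U" "card (A - {m}) = i" "A = insert m (A - {m})"
        using A by (auto simp: less_Suc_eq)
      moreover from this have "A - {m} \<in> set D'" using Dsat D'(2) by simp
      ultimately have "A \<in> insert m ` set D'" by (metis image_eqI)
      then show ?thesis by (simp add: vs_def)
    next
      case False
      then have "A \<subseteq> ?U" using A by (auto simp: less_Suc_eq)
      then show ?thesis using Qsat A by (simp add: vs_def)
    qed
  qed
  then show ?thesis by blast
qed

theorem saturating_cycle_exists: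
  "2 * j + 1 \<le> m \<Longrightarrow> \<exists>vs. saturating_cycle {..<m} j vs"
proof (induction m arbitrary: j)
  case (Suc m)
  show ?case
  proof (cases j)
    case 0
    \<comment> \<open>The empty set is the only set of size 0, and an edge run back and forth counts
      as a saturating cycle.\<close>
    have "saturating_cycle {..<Suc m} 0 [{0}, {}]"
      by (auto simp: saturating_cycle_def cycle_arcs_def inclusion_rel_def finite_subset)
    then show ?thesis using 0 by blast
  next
    case (Suc i)
    show ?thesis
    proof (cases "Suc m = 2 * j + 1")
      case True
      then show ?thesis using middle_levels[of j] Suc by simp
    next
      case False
      then have "2 * j + 1 \<le> m" using Suc.prems by simp
      then show ?thesis using Suc.IH[of j] Suc.IH[of i] saturating_cycle_step[of m i] Suc by auto
    qed
  qed
qed simp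

section \<open>Symmetric chains\<close>

text \<open>\<open>g A i\<close> is the member of size \<open>i\<close> of the chain through \<open>A\<close>, whose smallest member has size \<open>r A\<close>.\<close>

definition symmetric_chains :: "nat \<Rightarrow> (nat set \<Rightarrow> nat \<Rightarrow> nat set) \<Rightarrow> (nat set \<Rightarrow> nat) \<Rightarrow> bool" where
  "symmetric_chains m g r \<longleftrightarrow> (\<forall>A. A \<subseteq> {..<m} \<longrightarrow>
    r A \<le> card A \<and> card A + r A \<le> m \<and> g A (card A) = A \<and>
    (\<forall>i. r A \<le> i \<longrightarrow> i + r A \<le> m \<longrightarrow>
      g A i \<subseteq> {..<m} \<and> card (g A i) = i \<and> g (g A i) = g A \<and> r (g A i) = r A \<and>
      (\<forall>i'. i \<le> i' \<longrightarrow> i' + r A \<le> m \<longrightarrow> g A i \<subseteq> g A i')))"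

lemma symmetric_chainsD:
  assumes "symmetric_chains m g r" "A \<subseteq> {..<m}"
  shows "r A \<le> card A" "card A + r A \<le> m" "g A (card A) = A"
    and "\<And>i. r A \<le> i \<Longrightarrow> i + r A \<le> m \<Longrightarrow> g A i \<subseteq> {..<m} \<and> card (g A i) = i \<and> g (g A i) = g A \<and> r (g A i) = r A"
    and "\<And>i i'. r A \<le> i \<Longrightarrow> i \<le> i' \<Longrightarrow> i' + r A \<le> m \<Longrightarrow> g A i \<subseteq> g A i'"
proof -
  have H: "r A \<le> card A \<and> card A + r A \<le> m \<and> g A (card A) = A \<and>
    (\<forall>i. r A \<le> i \<longrightarrow> i + r A \<le> m \<longrightarrow>
      g A i \<subseteq> {..<m} \<and> card (g A i) = i \<and> g (g A i) = g A \<and> r (g A i) = r A \<and>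
      (\<forall>i'. i \<le> i' \<longrightarrow> i' + r A \<le> m \<longrightarrow> g A i \<subseteq> g A i'))"
    by (rule assms(1)[unfolded symmetric_chains_def, THEN spec, THEN mp, OF assms(2)])
  then show "r A \<le> card A" "card A + r A \<le> m" "g A (card A) = A" by simp_all
  fix i assume i: "r A \<le> i"
  show "g A i \<subseteq> {..<m} \<and> card (g A i) = i \<and> g (g A i) = g A \<and> r (g A i) = r A" if "i + r A \<le> m"
    using H i that by simp
  show "g A i \<subseteq> g A i'" if "i \<le> i'" "i' + r A \<le> m" for i'
    using H i that by simp
qed

text \<open>De Bruijn's recursion: a chain \<open>c\<^sub>1 \<subset> \<dots> \<subset> c\<^sub>h\<close> of subsets of \<open>{..<m}\<close> yields the chains
  \<open>c\<^sub>1, \<dots>, c\<^sub>h, c\<^sub>h \<union> {m}\<close> and \<open>c\<^sub>1 \<union> {m}, \<dots>, c\<^sub>h\<^sub>-\<^sub>1 \<union> {m}\<close>.\<close>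

lemma symmetric_chains_Suc:
  assumes "symmetric_chains m g r"
  shows "\<exists>g' r'. symmetric_chains (Suc m) g' r'"
proof -
  note D = symmetric_chainsD[OF assms]
  \<comment> \<open>Selects the extended chain \<open>c_1, ..., c_h, c_h \<union> {m}\<close>: the
    sets without \<open>m\<close>, and those whose rest is the top of its chain, where size and
    \<open>r\<close> sum to \<open>m\<close>.\<close>
  define lower where "lower A \<longleftrightarrow> m \<notin> A \<or> card (A - {m}) + r (A - {m}) = m" for A
  define g' where "g' A i = (let B = A - {m} in
    if lower A then if i + r B \<le> m then g B i else insert m (g B (m - r B)) else insert m (g B (i - 1)))" for A i
  define r' where "r' A = (if lower A then r (A - {m}) else Suc (r (A - {m})))" for A
  have m_notin: "m \<notin> B" if "B \<subseteq> {..<m}" for B using that by auto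
  have low: "g' X = (\<lambda>i. if i + r Y \<le> m then g Y i else insert m (g Y (m - r Y)))" "r' X = r Y"
    if "lower X" "X - {m} = Y" for X Y
    using that by (auto simp: fun_eq_iff g'_def r'_def Let_def)
  have high: "g' X = (\<lambda>i. insert m (g Y (i - 1)))" "r' X = Suc (r Y)"
    if "\<not> lower X" "X - {m} = Y" for X Y
    using that by (auto simp: fun_eq_iff g'_def r'_def Let_def)
  have "symmetric_chains (Suc m) g' r'"
    unfolding symmetric_chains_def
  proof (intro allI impI)
    fix A assume A: "A \<subseteq> {..<Suc m}"
    define B where "B = A - {m}"
    have B: "B \<subseteq> {..<m}" using A by (auto simp: B_def less_Suc_eq)
    note DB = D[OF B]
    have finB: "finite B" using B by (rule finite_subset) simp
    have gfin: "finite (g B i)" "m \<notin> g B i" "g B i - {m} = g B i" if "r B \<le> i" "i + r B \<le> m" for i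
      using DB(4)[OF that] finite_subset[of "g B i" "{..<m}"] by auto
    have AB: "A = (if m \<in> A then insert m B else B)" by (auto simp: B_def)
    have "card (insert m B) = Suc (card B)" using finB m_notin[OF B] by simp
    then have cardA: "card A = (if m \<in> A then Suc (card B) else card B)"
      using AB by (cases "m \<in> A") simp_all
    show "r' A \<le> card A \<and> card A + r' A \<le> Suc m \<and> g' A (card A) = A \<and>
      (\<forall>i. r' A \<le> i \<longrightarrow> i + r' A \<le> Suc m \<longrightarrow>
        g' A i \<subseteq> {..<Suc m} \<and> card (g' A i) = i \<and> g' (g' A i) = g' A \<and> r' (g' A i) = r' A \<and>
        (\<forall>i'. i \<le> i' \<longrightarrow> i' + r' A \<le> Suc m \<longrightarrow> g' A i \<subseteq> g' A i'))"
    proof (cases "lower A")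
      case True
      note lowA = low[OF True B_def[symmetric]]
      have r'A: "r' A = r B" by (rule lowA)
      have g'A: "g' A i = (if i + r B \<le> m then g B i else insert m (g B (m - r B)))" for i
        by (simp add: lowA)
      have m1: "m \<in> A \<Longrightarrow> card B + r B = m" using True by (simp add: lower_def B_def)
      have top: "r B \<le> m - r B" "m - r B + r B \<le> m" using DB(1,2) by auto
      have 1: "r' A \<le> card A" "card A + r' A \<le> Suc m"
        using DB(1,2) m1 by (auto simp: r'A cardA)
      have 2: "g' A (card A) = A"
      proof (cases "m \<in> A")
        case True
        then have "m - r B = card B" using m1 by simp
        then have "g' A (card A) = insert m B" using True m1 DB(3) by (simp add: g'A cardA)
        then show ?thesis using True AB by simp
      next
        case False
        then have "g' A (card A) = B" using DB(2,3) by (simp add: g'A cardA)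
        then show ?thesis using False AB by simp
      qed
      have 3: "g' A i \<subseteq> {..<Suc m} \<and> card (g' A i) = i \<and> g' (g' A i) = g' A \<and> r' (g' A i) = r' A"
        if i: "r' A \<le> i" "i + r' A \<le> Suc m" for i
      proof (cases "i + r B \<le> m")
        case True
        let ?X = "g B i"
        have i': "r B \<le> i" "i + r B \<le> m" using i True by (auto simp: r'A)
        note X = DB(4)[OF i'] gfin[OF i']
        have gX: "g' A i = ?X" using True by (simp add: g'A)
        have "lower ?X" using X by (simp add: lower_def)
        note lowX = low[OF this X(4)]
        have "g' ?X = g' A" "r' ?X = r' A" using X by (simp_all add: lowX lowA cong: if_cong)
        then show ?thesis using X gX by (auto simp: lessThan_Suc)
      next
        case False
        let ?Y = "g B (m - r B)"
        let ?X = "insert m ?Y"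
        note Y = DB(4)[OF top] gfin[OF top]
        have gX: "g' A i = ?X" using False by (simp add: g'A)
        have XY: "?X - {m} = ?Y" using Y by auto
        have "lower ?X" unfolding lower_def XY using Y top by simp
        note lowX = low[OF this XY]
        have "g' ?X = g' A" "r' ?X = r' A" using Y by (simp_all add: lowX lowA cong: if_cong)
        moreover have "card ?X = i" using Y False i top by (simp add: r'A)
        ultimately show ?thesis using Y gX by (auto simp: lessThan_Suc)
      qed
      have 4: "g' A i \<subseteq> g' A i'" if "r' A \<le> i" "i \<le> i'" "i' + r' A \<le> Suc m" for i i'
      proof -
        have "g B i \<subseteq> g B (m - r B)" if "i + r B \<le> m" "r B \<le> i"
          using DB(5)[of i "m - r B"] that top by simp
        then show ?thesis using DB(5)[of i i'] that by (auto simp: g'A r'A)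
      qed
      show ?thesis using 1 2 3 4 by blast
    next
      case False
      have mA: "m \<in> A" and cB: "card B + r B \<noteq> m" using False by (auto simp: lower_def B_def)
      note highA = high[OF False B_def[symmetric]]
      have r'A: "r' A = Suc (r B)" by (rule highA)
      have g'A: "g' A i = insert m (g B (i - 1))" for i by (simp add: highA)
      have 1: "r' A \<le> card A" "card A + r' A \<le> Suc m"
        using DB(1,2) cB mA by (auto simp: r'A cardA)
      have "g' A (card A) = insert m B" using DB(3) mA by (simp add: g'A cardA)
      then have 2: "g' A (card A) = A" using mA AB by simp
      have 3: "g' A i \<subseteq> {..<Suc m} \<and> card (g' A i) = i \<and> g' (g' A i) = g' A \<and> r' (g' A i) = r' A"
        if i: "r' A \<le> i" "i + r' A \<le> Suc m" for i
      proof -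
        let ?Y = "g B (i - 1)"
        let ?X = "insert m ?Y"
        have i': "r B \<le> i - 1" "i - 1 + r B \<le> m" using i by (auto simp: r'A)
        note Y = DB(4)[OF i'] gfin[OF i']
        have XY: "?X - {m} = ?Y" using Y by auto
        have "\<not> lower ?X" unfolding lower_def XY using Y i by (simp add: r'A)
        note highX = high[OF this XY]
        have "g' ?X = g' A" "r' ?X = r' A" unfolding highX highA using Y by simp_all
        moreover have "card ?X = i" using Y i by (simp add: r'A)
        ultimately show ?thesis using Y by (auto simp: lessThan_Suc g'A)
      qed
      have 4: "g' A i \<subseteq> g' A i'" if "r' A \<le> i" "i \<le> i'" "i' + r' A \<le> Suc m" for i i'
      proof -
        have "g B (i - 1) \<subseteq> g B (i' - 1)" using that by (intro DB(5)) (auto simp: r'A)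
        then show ?thesis by (auto simp: g'A)
      qed
      show ?thesis using 1 2 3 4 by blast
    qed
  qed
  then show ?thesis by blast
qed

lemma symmetric_chains_exist: "\<exists>g r. symmetric_chains m g r"
proof (induction m)
  case 0
  have "symmetric_chains 0 (\<lambda>A i. {}) (\<lambda>A. 0)" by (simp add: symmetric_chains_def)
  then show ?case by blast
next
  case (Suc m)
  then show ?case using symmetric_chains_Suc by blast
qed

text \<open>Each set goes to the member of size \<open>m - a\<close> of its symmetric chain. The
  chain gives the set back as its member of size \<open>a\<close>, whence injectivity.\<close>

lemma complementary_level_matching:
  assumes "2 * a \<le> m"
  shows "\<exists>\<phi>. inj_on \<phi> {A. A \<subseteq> {..<m} \<and> card A = a} \<and>
    (\<forall>A. A \<subseteq> {..<m} \<longrightarrow> card A = a \<longrightarrow> A \<subseteq> \<phi> A \<and> \<phi> A \<subseteq> {..<m} \<and> card (\<phi> A) = m - a)"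
proof -
  obtain g r where gr: "symmetric_chains m g r" using symmetric_chains_exist by blast
  note D = symmetric_chainsD[OF gr]
  have sub: "A \<subseteq> g A (m - a) \<and> g A (m - a) \<subseteq> {..<m} \<and> card (g A (m - a)) = m - a \<and> g (g A (m - a)) a = A"
    if A: "A \<subseteq> {..<m}" "card A = a" for A
  proof -
    have "r A \<le> a" "a \<le> m - a" "m - a + r A \<le> m" using D(1,2)[OF A(1)] A(2) assms by auto
    then show ?thesis using D(3)[OF A(1)] D(4)[OF A(1), of "m - a"] D(5)[OF A(1), of a "m - a"] A(2) by auto
  qed
  then have "inj_on (\<lambda>A. g A (m - a)) {A. A \<subseteq> {..<m} \<and> card A = a}"
    by (intro inj_onI) (metis (mono_tags, lifting) mem_Collect_eq)
  then show ?thesis using sub by (intro exI[of _ "\<lambda>A. g A (m - a)"]) blast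
qed

section \<open>Cycles in Kneser graphs\<close>

lemma set_zip_tl: "set (zip ws (tl ws)) = path_arcs ws"
  by (induction ws rule: path_arcs.induct) auto

lemma pcas_zip_tl: "ws \<noteq> [] \<Longrightarrow> pcas (hd ws) (zip ws (tl ws)) (last ws)"
  by (induction ws rule: path_arcs.induct) auto

lemma pawalk_verts_zip_tl: "ws \<noteq> [] \<Longrightarrow> pawalk_verts (hd ws) (zip ws (tl ws)) = ws"
  by (induction ws rule: path_arcs.induct) auto

text \<open>Repeating the first vertex at the end and zipping with the tail yields a closed
  walk.\<close>

lemma graph_cycle_of_vertices:
  assumes "distinct vs" "3 \<le> length vs" "set vs \<subseteq> pverts G" "cycle_arcs vs \<subseteq> parcs G"
  shows "\<exists>p. graph_cycle G p \<and> cycle_verts p = set vs"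
proof -
  have vs: "vs \<noteq> []" using assms(2) by auto
  define ws where "ws = vs @ [hd vs]"
  define p where "p = zip ws (tl ws)"
  have ws: "ws \<noteq> []" "hd ws = hd vs" "last ws = hd vs" "tl ws = tl vs @ [hd vs]"
    using vs by (auto simp: ws_def)
  have p: "set p = cycle_arcs vs"
    unfolding p_def set_zip_tl using vs by (simp add: ws_def path_arcs_append cycle_arcs_def)
  have len: "length p = length vs" by (simp add: p_def ws_def)
  have "map fst p = vs"
    unfolding p_def by (simp add: map_fst_zip_take ws_def)
  then have verts: "cycle_verts p = set vs" unfolding cycle_verts_def by (metis set_map)
  have "pcas (hd vs) p (hd vs)" using pcas_zip_tl[OF ws(1)] ws by (simp add: p_def)
  moreover have "hd vs \<in> pverts G" using assms(3) vs by auto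
  ultimately have "pre_digraph.awalk (with_proj G) (hd vs) p (hd vs)"
    using p assms(4) by (simp add: pre_digraph.awalk_def cas_with_proj_eq)
  moreover have "distinct (tl vs @ [hd vs])" using assms(1) vs by (cases vs) auto
  then have "distinct (tl (pre_digraph.awalk_verts (with_proj G) (hd vs) p))"
    using pawalk_verts_zip_tl[OF ws(1)] ws by (simp add: p_def awalk_verts_with_proj_eq)
  ultimately have "pre_digraph.cycle (with_proj G) p"
    unfolding pre_digraph.cycle_def using len assms(2) by force
  then show ?thesis using verts len assms(2) by (auto simp: graph_cycle_def)
qed

lemma kneser_graph_long_cycle:
  assumes "1 \<le> k" "2 * k + 1 \<le> n"
  shows "\<exists>p. graph_cycle (kneser_graph n k) p \<and> 2 * (n - 1 choose (k - 1)) \<le> card (cycle_verts p)"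
proof (cases "k = 1")
  case True
  \<comment> \<open>Here \<open>j = 0\<close> and a saturating cycle would have only two vertices; a
    triangle is long enough.\<close>
  let ?vs = "[{1}, {2}, {3 :: nat}]"
  have "\<exists>p. graph_cycle (kneser_graph n k) p \<and> cycle_verts p = set ?vs"
    by (rule graph_cycle_of_vertices) (use assms True in \<open>auto simp: kneser_graph_def cycle_arcs_def\<close>)
  then show ?thesis using True by auto
next
  case False
  define m j where "m = n - 1" and "j = k - 1"
  have n: "n = Suc m" and k: "k = Suc j" "1 \<le> j" "2 * j + 2 \<le> m" using assms False by (auto simp: m_def j_def)
  have "2 * j + 1 \<le> m" using k by simp
  then obtain vs where sat: "saturating_cycle {..<m} j vs" using saturating_cycle_exists by blast
  then have vs: "vs \<noteq> []" "distinct vs" "cycle_arcs vs \<subseteq> inclusion_rel"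
    and sub: "\<And>A. A \<in> set vs \<Longrightarrow> A \<subseteq> {..<m} \<and> (card A = j \<or> card A = Suc j)"
    unfolding saturating_cycle_def by blast+
  have "2 * Suc j \<le> m" using k by simp
  from complementary_level_matching[OF this] obtain \<phi> where
    \<phi>': "inj_on \<phi> {A. A \<subseteq> {..<m} \<and> card A = Suc j} \<and>
      (\<forall>A. A \<subseteq> {..<m} \<longrightarrow> card A = Suc j \<longrightarrow> A \<subseteq> \<phi> A \<and> \<phi> A \<subseteq> {..<m} \<and> card (\<phi> A) = m - Suc j)" ..
  have inj: "inj_on \<phi> {A. A \<subseteq> {..<m} \<and> card A = Suc j}" using \<phi>' by (rule conjunct1)
  have \<phi>: "A \<subseteq> \<phi> A \<and> \<phi> A \<subseteq> {..<m} \<and> card (\<phi> A) = m - Suc j" if "A \<subseteq> {..<m}" "card A = Suc j" for A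
    using \<phi>' that by simp
  \<comment> \<open>\<open>Suc\<close> carries \<open>{..<m}\<close> onto \<open>{1..m}\<close> and
    keeps \<open>n\<close> free. The complement of \<open>\<phi> A\<close> has
    \<open>m - (m - Suc j) = k\<close> elements.\<close>
  define F where "F A = (if card A = j then insert n (Suc ` A) else Suc ` ({..<m} - \<phi> A))" for A
  have fin: "finite A" if "A \<subseteq> {..<m}" for A using that by (rule finite_subset) simp
  have Suc_sub: "Suc ` A \<subseteq> {1..m}" if "A \<subseteq> {..<m}" for A using that by auto
  have n_notin: "n \<notin> Suc ` A" if "A \<subseteq> {..<m}" for A using that n by auto
  have vert: "F A \<subseteq> {1..n} \<and> card (F A) = k" if "A \<in> set vs" for A
  proof (cases "card A = j")
    case True
    have "A \<subseteq> {..<m}" using sub that by blast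
    then show ?thesis
      using Suc_sub[of A] n_notin[of A] fin[of A] True n k by (auto simp: F_def card_image)
  next
    case False
    then have A: "A \<subseteq> {..<m}" "card A = Suc j" using sub that by auto
    have "card ({..<m} - \<phi> A) = Suc j"
      using \<phi>[OF A] fin[of "\<phi> A"] k by (simp add: card_Diff_subset)
    then show ?thesis using Suc_sub[of "{..<m} - \<phi> A"] False n k by (auto simp: F_def card_image)
  qed
  have injF: "inj_on F (set vs)"
  proof (rule inj_onI)
    fix A B assume AB: "A \<in> set vs" "B \<in> set vs" "F A = F B"
    have AB_sub: "A \<subseteq> {..<m}" "B \<subseteq> {..<m}" using AB sub by blast+
    \<comment> \<open>\<open>n\<close> tells the two levels apart, which leaves injectivity within
      each level.\<close>
    have mem: "n \<in> F X \<longleftrightarrow> card X = j" for X using n_notin[of "{..<m} - \<phi> X"] by (auto simp: F_def)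
    show "A = B"
    proof (cases "card A = j")
      case True
      then have "card B = j" using mem AB(3) by metis
      then have "insert n (Suc ` A) = insert n (Suc ` B)" using AB(3) True by (simp add: F_def)
      then have "Suc ` A = Suc ` B" using n_notin AB_sub by (metis insert_ident)
      then show ?thesis by (simp add: inj_image_eq_iff)
    next
      case False
      then have cB: "card B \<noteq> j" using mem AB(3) by metis
      then have "Suc ` ({..<m} - \<phi> A) = Suc ` ({..<m} - \<phi> B)" using AB(3) False by (simp add: F_def)
      then have eq: "{..<m} - \<phi> A = {..<m} - \<phi> B" by (simp add: inj_image_eq_iff)
      have cards: "card A = Suc j" "card B = Suc j" using AB sub False cB by auto
      then have "\<phi> A \<subseteq> {..<m}" "\<phi> B \<subseteq> {..<m}" using \<phi> AB_sub by auto
      then have "\<phi> A = \<phi> B" using eq by blast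
      then show ?thesis using inj_onD[OF inj] cards AB_sub by blast
    qed
  qed
  have disj: "F A \<inter> F B = {}" if "A \<subseteq> {..<m}" "B \<subseteq> {..<m}" "A \<subseteq> B" "card A = j" "card B = Suc j" for A B
  proof -
    \<comment> \<open>The reason for the matching:
      \<open>A \<subseteq> B \<subseteq> \<phi> B\<close>, so \<open>A\<close> is disjoint from the
      complement that replaces \<open>B\<close>.\<close>
    have "A \<subseteq> \<phi> B" using \<phi>[of B] that by blast
    then have "Suc ` A \<inter> Suc ` ({..<m} - \<phi> B) = {}" by auto
    then show ?thesis using that n_notin[of "{..<m} - \<phi> B"] by (auto simp: F_def)
  qed
  have arcs: "cycle_arcs (map F vs) \<subseteq> parcs (kneser_graph n k)"
    unfolding cycle_arcs_map[OF vs(1)]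
  proof
    fix e assume "e \<in> map_prod F F ` cycle_arcs vs"
    then obtain A B where e: "e = (F A, F B)" "(A, B) \<in> cycle_arcs vs" by auto
    then have AB: "A \<in> set vs" "B \<in> set vs" using cycle_arcs_subset[OF vs(1)] by auto
    then have AB_sub: "A \<subseteq> {..<m}" "B \<subseteq> {..<m}" using sub by blast+
    from e vs(3) have "(A, B) \<in> inclusion_rel" by blast
    then consider a where "a \<notin> A" "B = insert a A" | a where "a \<notin> B" "A = insert a B"
      unfolding inclusion_rel_def by blast
    then have "F A \<inter> F B = {}"
    proof cases
      case 1
      then have "card B = Suc (card A)" using fin[OF AB_sub(1)] by simp
      then show ?thesis using disj[OF AB_sub] 1 sub[OF AB(1)] sub[OF AB(2)] by auto
    next
      case 2
      then have "card A = Suc (card B)" using fin[OF AB_sub(2)] by simp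
      then show ?thesis using disj[OF AB_sub(2,1)] 2 sub[OF AB(1)] sub[OF AB(2)] by auto
    qed
    then show "e \<in> parcs (kneser_graph n k)"
      using vert[OF AB(1)] vert[OF AB(2)] e(1) by (simp add: kneser_graph_def)
  qed
  have card_vs: "card (set vs) = 2 * (m choose j)"
  proof -
    have "card ({A \<in> set vs. card A = j} \<union> {A \<in> set vs. card A \<noteq> j})
        = card {A \<in> set vs. card A = j} + card {A \<in> set vs. card A \<noteq> j}"
      by (rule card_Un_disjoint) auto
    moreover have "{A \<in> set vs. card A = j} \<union> {A \<in> set vs. card A \<noteq> j} = set vs" by blast
    ultimately show ?thesis using saturating_cycle_card[OF sat] by simp
  qed
  \<comment> \<open>The cycle thus has at least \<open>2 * m\<close> vertices, which excludes a mere
    edge.\<close>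
  have "m choose 1 \<le> m choose j" using k by (intro binomial_mono) auto
  then have "3 \<le> length (map F vs)" using k card_vs distinct_card[OF vs(2)] by simp
  moreover have "distinct (map F vs)" using injF vs(2) by (simp add: distinct_map)
  moreover have "set (map F vs) \<subseteq> pverts (kneser_graph n k)"
    using vert by (auto simp: kneser_graph_def)
  ultimately obtain p where p: "graph_cycle (kneser_graph n k) p" "cycle_verts p = set (map F vs)"
    using graph_cycle_of_vertices[OF _ _ _ arcs] by blast
  have "card (cycle_verts p) = 2 * (n - 1 choose (k - 1))"
    using p(2) injF card_vs by (simp add: card_image m_def j_def)
  then show ?thesis using p(1) by (metis order_refl)
qed

text \<open>Absorption, \<open>k * (n choose k) = n * (n - 1 choose (k - 1))\<close>, turns the
  length of the cycle into the fraction.\<close>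

lemma kneser_graph_cycle_fraction:
  assumes "1 \<le> k" "2 * k + 1 \<le> n"
  shows "\<exists>p. graph_cycle (kneser_graph n k) p \<and>
    real (card (cycle_verts p)) \<ge> (2 * real k / real n) * real (card (pverts (kneser_graph n k)))"
proof -
  obtain p where p: "graph_cycle (kneser_graph n k) p" "2 * (n - 1 choose (k - 1)) \<le> card (cycle_verts p)"
    using kneser_graph_long_cycle[OF assms] by blast
  have "k * (n choose k) = n * (n - 1 choose (k - 1))"
    using binomial_absorption[of "k - 1" n] assms(1) by simp
  then have "real k * real (n choose k) = real n * real (n - 1 choose (k - 1))"
    by (metis of_nat_mult)
  then have "(2 * real k / real n) * real (n choose k) = 2 * real (n - 1 choose (k - 1))"
    using assms by (simp add: field_simps)
  moreover have "2 * real (n - 1 choose (k - 1)) \<le> real (card (cycle_verts p))"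
    using p(2) by (metis of_nat_le_iff of_nat_mult of_nat_numeral)
  ultimately show ?thesis using p(1) by (auto simp: card_pverts_kneser_graph)
qed

theorem theorem11:
  shows "(\<forall>k n :: nat. 1 \<le> k \<longrightarrow> 2 * k + 1 \<le> n \<longrightarrow>
            (\<exists>p. graph_cycle (kneser_graph n k) p \<and>
                 real (card (cycle_verts p)) \<ge>
                   (2 * real k / real n) * real (card (pverts (kneser_graph n k)))))
       \<and> (\<forall>k :: nat. 1 \<le> k \<longrightarrow>
            (\<exists>p. graph_cycle (odd_graph k) p \<and>
                 real (card (cycle_verts p)) \<ge>
                   (1 - 1 / (2 * real k + 1)) * real (card (pverts (odd_graph k)))))"
proof (intro conjI allI impI)
  fix k n :: nat assume "1 \<le> k" "2 * k + 1 \<le> n"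
  then show "\<exists>p. graph_cycle (kneser_graph n k) p \<and>
    real (card (cycle_verts p)) \<ge> (2 * real k / real n) * real (card (pverts (kneser_graph n k)))"
    by (rule kneser_graph_cycle_fraction)
next
  fix k :: nat assume "1 \<le> k"
  then have "\<exists>p. graph_cycle (odd_graph k) p \<and> real (card (cycle_verts p)) \<ge>
      (2 * real k / real (2 * k + 1)) * real (card (pverts (odd_graph k)))"
    unfolding odd_graph_def by (rule kneser_graph_cycle_fraction) simp
  moreover have "2 * real k / real (2 * k + 1) = 1 - 1 / (2 * real k + 1)"
    by (simp add: field_simps)
  ultimately show "\<exists>p. graph_cycle (odd_graph k) p \<and>
      real (card (cycle_verts p)) \<ge> (1 - 1 / (2 * real k + 1)) * real (card (pverts (odd_graph k)))"
    by metis
qed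

end
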